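(* Let $x=(x_1,\dots,x_m)$ and $y=(y_1,\dots,y_n)$ be tuples of indeterminates, let $f_1,\dots,f_m\in\mathbb{C}[y][x]$, put $F=(f_1,\dots,f_m)$, and suppose that the ideal $\mathcal{I}=\langle f_1,\dots,f_m\rangle\subset\mathbb{C}(y)[x]$ is zero-dimensional and radical, with zero-set $\mathcal{Z}(\mathcal{I})\subset\overline{\mathbb{C}(y)}^m$ consisting of $d$ points. Let $\mathcal{G}$ be a Gröbner basis of $\mathcal{I}$, let $\{e_\alpha\}_{\alpha=1}^d$ be the associated standard basis of $\mathcal{Q}=\mathbb{C}(y)[x]/\mathcal{I}$, let $\{\Delta_\alpha\}_{\alpha=1}^d$ be its dual basis with respect to the global residue pairing, and write $1=\sum_{\alpha=1}^d\mu_\alpha\Delta_\alpha$ in $\mathcal{Q}$ with $\mu_\alpha\in\mathbb{C}(y)$. Let $\omega(x)=\frac{h(x)}{q(x)}\,dx_1\wedge\cdots\wedge dx_m$ be a rational $m$-form with $h,q$ polynomials such that $\mathcal{Z}(\langle q\rangle+\mathcal{I})=\emptyset$, and let $q_{\mathrm{inv}}\in\mathbb{C}(y)[x]$ be a polynomial inverse of $q$ modulo $\mathcal{I}$. Then the pushforward of $\omega$ via $\mathcal{I}$ is $$\mathcal{I}_\ast\omega=\sum_{J\in\binom{[n]}{m}}\left((-1)^m\sum_{\alpha=1}^d\mu_\alpha\,\overline{\left(\left|\frac{\partial F}{\partial y}\right|_{J}h\,q_{\mathrm{inv}}\right)}_{\alpha}\right)\bigwedge_{j\in J}dy_j ,$$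 where, for $g\in\mathbb{C}(y)[x]$, $\overline{g}_\alpha\in\mathbb{C}(y)$ denotes the coefficient of $e_\alpha$ in the normal form $\overline{g}^{\mathcal{G}}=\sum_{\alpha=1}^d\overline{g}_\alpha e_\alpha$.
   Context: $[n]=\{1,\dots,n\}$ and $\binom{[n]}{m}$ is the set of $m$-element subsets, taken in increasing order. $\overline{\mathbb{C}(y)}$ is the algebraic closure of $\mathbb{C}(y)$; the derivations $\partial/\partial y_j$ of $\mathbb{C}(y)$ extend uniquely to it. $\partial F/\partial x$ is the $m\times m$ matrix with entries $\partial f_\ell/\partial x_i$, and $\partial F/\partial y$ is the $m\times n$ matrix with entries $\partial f_\ell/\partial y_j$ (with $x$ and $y$ treated as independent variables). $|\partial F/\partial x|$ is the determinant, and $|\partial F/\partial y|_J$ is the maximal minor of $\partial F/\partial y$ with column set $J$. Under the hypotheses $|\partial F/\partial x|$ is non-zero at every point of $\mathcal{Z}(\mathcal{I})$. Pushforward: for $\omega=\underline{\omega}\,dx_1\wedge\cdots\wedge dx_m$, $$\mathcal{I}_\ast\omega=\sum_{\xi\in\mathcal{Z}(\mathcal{I})}\xi^\ast\omega=\sum_{J\in\binom{[n]}{m}}\Big(\sum_{\xi\in\mathcal{Z}(\mathcal{I})}\underline{\omega}(\xi)\left|\frac{\partial\xi}{\partial y}\right|_{J}\Big)\bigwedge_{j\in J}dy_j,$$ where $\partial\xi/\partial y$ is the $m\times n$ matrix with entries $\partial\xi_i/\partial y_j\in\overline{\mathbb{C}(y)}$. The standard basis associated with $\mathcal{G}$ is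 the set of monomials in $x$ not divisible by any leading term of $\mathcal{G}$. The normal form $\overline{g}^{\mathcal{G}}$ is the remainder of $g$ on division by $\mathcal{G}$. Global residue: for $g\in\mathbb{C}(y)[x]$, $\operatorname{Res}_F(g)=\sum_{\xi\in\mathcal{Z}(\mathcal{I})}g(\xi)\,\left|\frac{\partial F}{\partial x}(\xi)\right|^{-1}\in\mathbb{C}(y)$. The pairing $\langle[g_1],[g_2]\rangle=\operatorname{Res}_F(g_1g_2)$ on $\mathcal{Q}$ is symmetric, $\mathbb{C}(y)$-bilinear and non-degenerate, and the dual basis is defined by $\langle e_\alpha,\Delta_\beta\rangle=\delta_{\alpha\beta}$. Polynomial inverse: $q_{\mathrm{inv}}\in\mathbb{C}(y)[x]$ is any polynomial with $q\,q_{\mathrm{inv}}-1\in\mathcal{I}$. *)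

theory Defs
  imports
    "HOL-Analysis.Determinants"
    "HOL-Library.Poly_Mapping"
    "HOL-Computational_Algebra.Fraction_Field"
    "HOL-Algebra.Algebraic_Closure_Type"
begin

section \<open>Polynomials in several indeterminates\<close>

text \<open>
  The indeterminates \<open>x\<^sub>1, \<dots>, x\<^sub>m\<close> and \<open>y\<^sub>1, \<dots>, y\<^sub>n\<close> are indexed by finite linearly ordered types
  \<open>'m\<close> and \<open>'n\<close>, so that \<open>m = CARD('m)\<close> and \<open>n = CARD('n)\<close>.  A monomial is its exponent vector.
\<close>

type_synonym 'v mon = "'v \<Rightarrow>\<^sub>0 nat"
type_synonym ('v, 'a) mpoly = "'v mon \<Rightarrow>\<^sub>0 'a"

text \<open>\<open>\<complex>[y]\<close>, \<open>\<complex>(y)\<close>, the algebraic closure of \<open>\<complex>(y)\<close>, \<open>\<complex>[y][x]\<close> and \<open>\<complex>(y)[x]\<close>:\<close>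

type_synonym 'n Cy = "('n, complex) mpoly"
type_synonym 'n Ky = "'n Cy fract"
type_synonym 'n Kbar = "'n Ky alg_closure"
type_synonym ('m, 'n) Cyx = "('m, 'n Cy) mpoly"
type_synonym ('m, 'n) Kyx = "('m, 'n Ky) mpoly"

definition monomial :: "'v mon \<Rightarrow> ('v, 'a::zero_neq_one) mpoly" where
  "monomial t = Poly_Mapping.single t 1"

definition mconst :: "'a::zero \<Rightarrow> ('v, 'a) mpoly" where
  "mconst c = Poly_Mapping.single 0 c"

text \<open>Partial derivative; for \<open>i\<close> not occurring in \<open>t\<close> the (truncated) exponent is irrelevant
  because the coefficient vanishes.\<close>

definition mpderiv :: "'v \<Rightarrow> ('v, 'a::comm_semiring_1) mpoly \<Rightarrow> ('v, 'a) mpoly" where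
  "mpderiv i p = (\<Sum>t\<in>Poly_Mapping.keys p.
     Poly_Mapping.single (t - Poly_Mapping.single i 1)
       (of_nat (Poly_Mapping.lookup t i) * Poly_Mapping.lookup p t))"

definition Cy_to_Ky :: "'n::{finite,linorder} Cy \<Rightarrow> 'n Ky" where
  "Cy_to_Ky p = Fract p 1"

definition Cyx_to_Kyx :: "('m, 'n::{finite,linorder}) Cyx \<Rightarrow> ('m, 'n) Kyx" where
  "Cyx_to_Kyx p = Poly_Mapping.map Cy_to_Ky p"

definition eval_at :: "('m::finite, 'n::{finite,linorder}) Kyx \<Rightarrow> ('n Kbar, 'm) vec \<Rightarrow> 'n Kbar" where
  "eval_at p \<xi> = (\<Sum>t\<in>Poly_Mapping.keys p.
     to_ac (Poly_Mapping.lookup p t) * (\<Prod>i\<in>UNIV. (\<xi> $ i) ^ Poly_Mapping.lookup t i))"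

section \<open>Ideals\<close>

definition ideal_gen :: "'a::comm_ring_1 set \<Rightarrow> 'a set" where
  "ideal_gen S = module.span (*) S"

definition ideal_sum :: "'a::comm_ring_1 set \<Rightarrow> 'a set \<Rightarrow> 'a set" where
  "ideal_sum I J = {a + b | a b. a \<in> I \<and> b \<in> J}"

definition radical_ideal :: "'a::comm_ring_1 set \<Rightarrow> bool" where
  "radical_ideal I \<longleftrightarrow> (\<forall>p k::nat. p ^ k \<in> I \<longrightarrow> p \<in> I)"

text \<open>The quotient ring is a finite-dimensional vector space.\<close>

definition zero_dimensional :: "('m, 'a::field) mpoly set \<Rightarrow> bool" where
  "zero_dimensional I \<longleftrightarrow>
     (\<exists>S. finite S \<and> (\<forall>g. \<exists>c. g - (\<Sum>s\<in>S. mconst (c s) * s) \<in> I))"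

definition zero_set :: "('m::finite, 'n::{finite,linorder}) Kyx set \<Rightarrow> ('n Kbar, 'm) vec set" where
  "zero_set I = {\<xi>. \<forall>p\<in>I. eval_at p \<xi> = 0}"

definition ideal_of :: "('m \<Rightarrow> ('m, 'n::{finite,linorder}) Cyx) \<Rightarrow> ('m, 'n) Kyx set" where
  "ideal_of F = ideal_gen (range (\<lambda>l. Cyx_to_Kyx (F l)))"

section \<open>Groebner bases and normal forms\<close>

definition monomial_order :: "('v mon \<Rightarrow> 'v mon \<Rightarrow> bool) \<Rightarrow> bool" where
  "monomial_order mle \<longleftrightarrow>
     class.linorder mle (\<lambda>s t. mle s t \<and> s \<noteq> t) \<and>
     wfp (\<lambda>s t. mle s t \<and> s \<noteq> t) \<and>
     (\<forall>s t u. mle s t \<longrightarrow> mle (s + u) (t + u))"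

text \<open>Leading monomials and terms are meaningful for nonzero polynomials only.\<close>

definition lead_mon :: "('v mon \<Rightarrow> 'v mon \<Rightarrow> bool) \<Rightarrow> ('v, 'a::zero) mpoly \<Rightarrow> 'v mon" where
  "lead_mon mle p = (THE t. t \<in> Poly_Mapping.keys p \<and> (\<forall>s\<in>Poly_Mapping.keys p. mle s t))"

definition lead_term ::
  "('v mon \<Rightarrow> 'v mon \<Rightarrow> bool) \<Rightarrow> ('v, 'a::zero) mpoly \<Rightarrow> ('v, 'a) mpoly" where
  "lead_term mle p =
     Poly_Mapping.single (lead_mon mle p) (Poly_Mapping.lookup p (lead_mon mle p))"

definition groebner_basis ::
  "('v mon \<Rightarrow> 'v mon \<Rightarrow> bool) \<Rightarrow> ('v, 'a::field) mpoly set \<Rightarrow> ('v, 'a) mpoly set \<Rightarrow> bool" where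
  "groebner_basis mle I G \<longleftrightarrow> finite G \<and> G \<subseteq> I - {0} \<and>
     ideal_gen (lead_term mle ` G) = ideal_gen (lead_term mle ` (I - {0}))"

definition std_monomials ::
  "('v mon \<Rightarrow> 'v mon \<Rightarrow> bool) \<Rightarrow> ('v, 'a::field) mpoly set \<Rightarrow> 'v mon set" where
  "std_monomials mle G = {t. \<forall>g\<in>G. \<not> lead_term mle g dvd monomial t}"

text \<open>\<open>r\<close> is a remainder of \<open>g\<close> on division by \<open>G\<close>, in the sense of the division algorithm; for a
  Groebner basis it is unique.\<close>

definition is_remainder ::
  "('v mon \<Rightarrow> 'v mon \<Rightarrow> bool) \<Rightarrow> ('v, 'a::field) mpoly set \<Rightarrow> ('v, 'a) mpoly \<Rightarrow> ('v, 'a) mpoly \<Rightarrow> bool"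
  where
  "is_remainder mle G g r \<longleftrightarrow>
     (\<exists>a. g = (\<Sum>p\<in>G. a p * p) + r \<and>
          (\<forall>p\<in>G. a p * p \<noteq> 0 \<longrightarrow> mle (lead_mon mle (a p * p)) (lead_mon mle g))) \<and>
     Poly_Mapping.keys r \<subseteq> std_monomials mle G"

definition normal_form ::
  "('v mon \<Rightarrow> 'v mon \<Rightarrow> bool) \<Rightarrow> ('v, 'a::field) mpoly set \<Rightarrow> ('v, 'a) mpoly \<Rightarrow> ('v, 'a) mpoly" where
  "normal_form mle G g = (THE r. is_remainder mle G g r)"

section \<open>Derivations of the algebraic closure\<close>

text \<open>The extension of \<open>\<partial>/\<partial>y\<^sub>j\<close>. It is enough to prescribe it on \<open>\<complex>[y]\<close>: the Leibniz rule then gives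
  the quotient rule on \<open>\<complex>(y)\<close>.\<close>

definition extends_pderiv :: "'n::{finite,linorder} \<Rightarrow> ('n Kbar \<Rightarrow> 'n Kbar) \<Rightarrow> bool" where
  "extends_pderiv j D \<longleftrightarrow>
     (\<forall>a b. D (a + b) = D a + D b) \<and>
     (\<forall>a b. D (a * b) = a * D b + b * D a) \<and>
     (\<forall>p. D (to_ac (Cy_to_Ky p)) = to_ac (Cy_to_Ky (mpderiv j p)))"

definition pderiv_bar :: "'n::{finite,linorder} \<Rightarrow> 'n Kbar \<Rightarrow> 'n Kbar" where
  "pderiv_bar j = (THE D. extends_pderiv j D)"

section \<open>Jacobians and maximal minors\<close>

text \<open>The columns of a maximal minor are taken in increasing order: the column with position
  \<open>i :: 'm\<close> is the element of \<open>J\<close> having exactly as many predecessors in \<open>J\<close> as \<open>i\<close> has in \<open>'m\<close>.\<close>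

definition nth_col :: "'n::linorder set \<Rightarrow> 'm::{finite,linorder} \<Rightarrow> 'n" where
  "nth_col J i = sorted_list_of_set J ! card {k. k < i}"

definition max_minor ::
  "'n::{finite,linorder} set \<Rightarrow> (('a::comm_ring_1, 'n) vec, 'm::{finite,linorder}) vec \<Rightarrow> 'a" where
  "max_minor J A = det (\<chi> l i. A $ l $ nth_col J i)"

definition jac_x :: "('m::finite \<Rightarrow> ('m, 'n::{finite,linorder}) Cyx) \<Rightarrow> ((('m, 'n) Cyx, 'm) vec, 'm) vec" where
  "jac_x F = (\<chi> l i. mpderiv i (F l))"

definition jac_y :: "('m::finite \<Rightarrow> ('m, 'n::{finite,linorder}) Cyx) \<Rightarrow> ((('m, 'n) Cyx, 'n) vec, 'm) vec" where
  "jac_y F = (\<chi> l j. Poly_Mapping.map (mpderiv j) (F l))"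

definition jac_point :: "('n::{finite,linorder} Kbar, 'm::finite) vec \<Rightarrow> (('n Kbar, 'n) vec, 'm) vec" where
  "jac_point \<xi> = (\<chi> i j. pderiv_bar j (\<xi> $ i))"

section \<open>Global residue and pushforward\<close>

definition residue ::
  "('m::{finite,linorder} \<Rightarrow> ('m, 'n::{finite,linorder}) Cyx) \<Rightarrow> ('m, 'n) Kyx \<Rightarrow> 'n Kbar" where
  "residue F g = (\<Sum>\<xi>\<in>zero_set (ideal_of F).
     eval_at g \<xi> * inverse (eval_at (Cyx_to_Kyx (det (jac_x F))) \<xi>))"

text \<open>A class in the quotient ring is given by a representative.\<close>

definition residue_pairing ::
  "('m::{finite,linorder} \<Rightarrow> ('m, 'n::{finite,linorder}) Cyx) \<Rightarrow>
     ('m, 'n) Kyx \<Rightarrow> ('m, 'n) Kyx \<Rightarrow> 'n Kbar" where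
  "residue_pairing F g1 g2 = residue F (g1 * g2)"

text \<open>Differential forms in \<open>y\<close> over the algebraic closure: the free module on the wedge products
  \<open>dy\<^sub>J\<close> of the \<open>dy\<^sub>j\<close>, \<open>j \<in> J\<close>, taken in increasing order. The form \<open>c dy\<^sub>J\<close> is
  \<open>Poly_Mapping.single J c\<close>.\<close>

type_synonym 'n form = "'n set \<Rightarrow>\<^sub>0 'n Kbar"

text \<open>Pullback of \<open>h/q dx\<^sub>1 \<and> \<dots> \<and> dx\<^sub>m\<close> along the point \<open>\<xi>\<close>, viewed as an algebraic function of \<open>y\<close>.\<close>

definition pullback :: "('m::{finite,linorder}, 'n::{finite,linorder}) Kyx \<Rightarrow> ('m, 'n) Kyx \<Rightarrow>
    ('n Kbar, 'm) vec \<Rightarrow> 'n form" where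
  "pullback h q \<xi> = (\<Sum>J | card J = CARD('m).
     Poly_Mapping.single J (eval_at h \<xi> / eval_at q \<xi> * max_minor J (jac_point \<xi>)))"

definition pushforward :: "('m::{finite,linorder}, 'n::{finite,linorder}) Kyx set \<Rightarrow>
    ('m, 'n) Kyx \<Rightarrow> ('m, 'n) Kyx \<Rightarrow> 'n form" where
  "pushforward I h q = (\<Sum>\<xi>\<in>zero_set I. pullback h q \<xi>)"

end

theory Submission
  imports Defs
begin

text \<open>
  Let \<open>E\<close> be the matrix of the values \<open>e\<^sub>\<alpha>(\<xi>)\<close>, and \<open>M\<close> that of the values
  \<open>\<Delta>\<^sub>\<beta>(\<xi>) |\<partial>F/\<partial>x|(\<xi>)\<^sup>-\<^sup>1\<close>.  Duality of the bases says \<open>E M = 1\<close>.  The zeros are separated by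
  polynomials over the algebraic closure, and these reduce to combinations of standard monomials, so
  \<open>E\<close> has a left inverse, which must be \<open>M\<close>.  Comparing traces, the number of standard monomials is
  the number of zeros; and no row of \<open>M\<close> vanishes, so \<open>|\<partial>F/\<partial>x|\<close> has no zero on the zero-set.
  Differentiating \<open>F(\<xi>(y), y) = 0\<close> gives \<open>\<partial>F/\<partial>x \<cdot> \<partial>\<xi>/\<partial>y = - \<partial>F/\<partial>y\<close>; taking minors, the pushforward
  becomes a sum of residues, and \<open>Res(g) = \<langle>g, 1\<rangle> = \<Sum>\<^sub>\<alpha> \<mu>\<^sub>\<alpha> g\<^sub>\<alpha>\<close>.
\<close>

section \<open>Extending derivations\<close>

definition derivation :: "('a::comm_ring_1 \<Rightarrow> 'a) \<Rightarrow> bool" where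
  "derivation D \<longleftrightarrow> (\<forall>a b. D (a + b) = D a + D b) \<and> (\<forall>a b. D (a * b) = a * D b + b * D a)"

section \<open>Calculus with derivations, and their extension to algebraic closures\<close>

lemma derivation_add: "derivation D \<Longrightarrow> D (a + b) = D a + D b"
  and derivation_mult: "derivation D \<Longrightarrow> D (a * b) = a * D b + b * D a"
  by (auto simp: derivation_def)

lemma derivation_0: "derivation D \<Longrightarrow> D 0 = 0"
  using derivation_add[of D 0 0] by simp

lemma derivation_1: "derivation D \<Longrightarrow> D 1 = 0"
  using derivation_mult[of D 1 1] by simp

lemma derivation_minus: "derivation D \<Longrightarrow> D (- a) = - D a"
  using derivation_add[of D a "- a"] derivation_0[of D] by (simp add: eq_neg_iff_add_eq_0 add.commute)

lemma derivation_power: "derivation D \<Longrightarrow> D (a ^ k) = of_nat k * a ^ (k - 1) * D a"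
proof (induction k)
  case (Suc k)
  then show ?case
    by (cases k) (auto simp: derivation_mult[of D] algebra_simps)
qed (simp add: derivation_1[of D])

lemma derivation_prod:
  assumes "derivation D" "finite A"
  shows "D (prod f A) = (\<Sum>x\<in>A. D (f x) * prod f (A - {x}))"
  using assms(2)
proof (induction A rule: finite_induct)
  case (insert x A)
  have "(\<Sum>y\<in>A. D (f y) * prod f (insert x A - {y})) = f x * (\<Sum>y\<in>A. D (f y) * prod f (A - {y}))"
    unfolding sum_distrib_left
  proof (rule sum.cong)
    fix y assume "y \<in> A"
    then have "insert x A - {y} = insert x (A - {y})" using insert by auto
    then show "D (f y) * prod f (insert x A - {y}) = f x * (D (f y) * prod f (A - {y}))"
      using insert by (simp add: mult_ac)
  qed simp
  then show ?case using insert assms(1) by (simp add: derivation_mult[of D] insert_Diff_if)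
qed (simp add: derivation_1[OF assms(1)])

text \<open>A set of pairs closed under these operations is a subring of the dual numbers
  \<open>L[\<epsilon>]\<close>, the pair \<open>(a, u)\<close> standing for \<open>a + u\<epsilon>\<close>; being single-valued, it is the graph of a
  derivation on a subring of \<open>L\<close>.\<close>

definition derivation_graph :: "('a \<Rightarrow> 'a) \<Rightarrow> ('a::field alg_closure \<times> 'a alg_closure) set \<Rightarrow> bool" where
  "derivation_graph d R \<longleftrightarrow>
     (\<forall>a u v. (a, u) \<in> R \<longrightarrow> (a, v) \<in> R \<longrightarrow> u = v) \<and>
     (\<forall>c. (to_ac c, to_ac (d c)) \<in> R) \<and>
     (\<forall>a u b v. (a, u) \<in> R \<longrightarrow> (b, v) \<in> R \<longrightarrow> (a + b, u + v) \<in> R) \<and>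
     (\<forall>a u b v. (a, u) \<in> R \<longrightarrow> (b, v) \<in> R \<longrightarrow> (a * b, a * v + b * u) \<in> R)"

lemma derivation_graph_sum:
  assumes "derivation_graph d R" "derivation d" "\<And>i. i \<in> A \<Longrightarrow> (f i, g i) \<in> R"
  shows "(sum f A, sum g A) \<in> R"
proof -
  have "(to_ac 0, to_ac (d 0)) \<in> R" using assms(1) unfolding derivation_graph_def by blast
  then have 0: "(0, 0) \<in> R" using derivation_0[OF assms(2)] by simp
  show ?thesis using assms(3)
    by (induction A rule: infinite_finite_induct)
      (use 0 assms(1) in \<open>auto simp: derivation_graph_def\<close>)
qed

text \<open>Adjoin \<open>a\<close> to the domain of \<open>M\<close>: its derivative is forced by
  an algebraic relation of least degree, and maximality makes the enlarged graph equal to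
  \<open>M\<close>. The domain is only known to be a ring, so relations are not normalised to be
  monic.\<close>

lemma derivation_graph_maximal:
  fixes a :: "'a::field_char_0 alg_closure"
  assumes d: "derivation d" and M: "derivation_graph d M"
    and max: "\<And>R. derivation_graph d R \<Longrightarrow> M \<subseteq> R \<Longrightarrow> R = M"
  shows "\<exists>u. (a, u) \<in> M"
proof -
  have single: "u = v" if "(x, u) \<in> M" "(x, v) \<in> M" for x u v
    using M that unfolding derivation_graph_def by blast
  have const: "(to_ac c, to_ac (d c)) \<in> M" for c
    using M unfolding derivation_graph_def by blast
  have add: "(x + y, u + v) \<in> M" if "(x, u) \<in> M" "(y, v) \<in> M" for x y u v
    using M that unfolding derivation_graph_def by blast
  have mult: "(x * y, x * v + y * u) \<in> M" if "(x, u) \<in> M" "(y, v) \<in> M" for x y u v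
    using M that unfolding derivation_graph_def by blast
  have M0: "(0, 0) \<in> M" and M1: "(1, 0) \<in> M" and Mm1: "(-1, 0) \<in> M"
    using const[of 0] const[of 1] const[of "- 1"]
    by (simp_all add: derivation_0[OF d] derivation_1[OF d] derivation_minus[OF d])
  \<comment> \<open>A pair \<open>(g, h)\<close> in \<open>P\<close> is a polynomial
    \<open>g + h \<epsilon>\<close> over the dual-number ring \<open>M\<close>: \<open>h\<close> is
    \<open>g\<close> with its coefficients differentiated.\<close>
  define P where "P = {(g, h). \<forall>i. (Polynomial.coeff g i, Polynomial.coeff h i) \<in> M}"
  have Padd: "(g + g', h + h') \<in> P" if "(g, h) \<in> P" "(g', h') \<in> P" for g h g' h'
    using that add by (auto simp: P_def)
  have Pmult: "(g * g', g * h' + g' * h) \<in> P" if "(g, h) \<in> P" "(g', h') \<in> P" for g h g' h'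
  proof -
    have "(Polynomial.coeff (g * g') i, Polynomial.coeff (g * h' + g' * h) i) \<in> M" for i
    proof -
      have "Polynomial.coeff (g' * h) i = (\<Sum>k\<le>i. Polynomial.coeff g' (i - k) * Polynomial.coeff h k)"
        unfolding mult.commute[of g' h] coeff_mult by (rule sum.cong) (simp_all add: mult.commute)
      then have "Polynomial.coeff (g * h' + g' * h) i =
          (\<Sum>k\<le>i. Polynomial.coeff g k * Polynomial.coeff h' (i - k) +
            Polynomial.coeff g' (i - k) * Polynomial.coeff h k)"
        by (simp add: coeff_mult sum.distrib)
      then show ?thesis
        unfolding coeff_mult
        using that mult by (auto intro!: derivation_graph_sum[OF M d] simp: P_def)
    qed
    then show ?thesis by (simp add: P_def)
  qed
  have Pmonom: "(Polynomial.monom x k, Polynomial.monom u k) \<in> P" if "(x, u) \<in> M" for x u k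
    using that M0 by (auto simp: P_def)
  have Pconst: "([:x:], [:u:]) \<in> P" if "(x, u) \<in> M" for x u
    using Pmonom[OF that, of 0] by (simp add: monom_0)
  have Pdiff: "(g - g', h - h') \<in> P" if "(g, h) \<in> P" "(g', h') \<in> P" for g h g' h'
    using Padd[OF that(1) Pmult[OF Pconst[OF Mm1] that(2)]] by simp

  \<comment> \<open>Relations for \<open>a\<close> with coefficients in the domain of
    \<open>M\<close>. One exists because \<open>a\<close> is algebraic over the base field;
    \<open>p\<close> is one of least degree.\<close>
  let ?root = "\<lambda>g. g \<noteq> 0 \<and> poly g a = 0 \<and> (\<exists>h. (g, h) \<in> P)"
  obtain p0 :: "'a poly" where p0: "p0 \<noteq> 0" "poly (map_poly to_ac p0) a = 0"
    using alg_closure_algebraic by blast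
  have "(map_poly to_ac p0, map_poly (to_ac \<circ> d) p0) \<in> P"
    using const by (auto simp: P_def coeff_map_poly derivation_0[OF d])
  moreover have "map_poly to_ac p0 \<noteq> 0"
    using p0(1) by (simp add: poly_eq_iff coeff_map_poly)
  ultimately have "?root (map_poly to_ac p0)" using p0 by blast
  from ex_has_least_nat[of ?root, OF this, of Polynomial.degree]
  obtain p where p: "?root p" and least: "\<And>g. ?root g \<Longrightarrow> Polynomial.degree p \<le> Polynomial.degree g"
    by blast
  then obtain p' where p': "(p, p') \<in> P" by blast
  have degp: "Polynomial.degree p > 0"
  proof (rule ccontr)
    assume "\<not> Polynomial.degree p > 0"
    then obtain c where "p = [:c:]" using degree_eq_zeroE by blast
    then show False using p by auto
  qed
  \<comment> \<open>Separability in characteristic zero: the derivative of \<open>p\<close> again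
    has coefficients in the domain, is nonzero and has smaller degree, so by minimality
    \<open>a\<close> is not a root of it.\<close>
  have "(Polynomial.pderiv p, Polynomial.pderiv p') \<in> P"
  proof -
    have "(of_nat n * x, of_nat n * u) \<in> M" if "(x, u) \<in> M" for n x u
      by (induction n) (use M0 add that in \<open>auto simp: algebra_simps\<close>)
    then show ?thesis using p' by (simp add: P_def coeff_pderiv del: of_nat_Suc)
  qed
  moreover have "Polynomial.pderiv p \<noteq> 0" "Polynomial.degree (Polynomial.pderiv p) < Polynomial.degree p"
    using degp by (auto simp: pderiv_eq_0_iff degree_pderiv)
  ultimately have p'a: "poly (Polynomial.pderiv p) a \<noteq> 0"
    using least[of "Polynomial.pderiv p"] by fastforce
  \<comment> \<open>\<open>T g h\<close> is the only possible derivative of \<open>g(a)\<close>, where \<open>h\<close> is \<open>g\<close> with differentiated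
    coefficients; \<open>u\<close>, the derivative of \<open>a\<close>, is forced by \<open>T p p' = 0\<close>. The value depends on \<open>g(a)\<close> only,
    as one sees by pseudo-division by \<open>p\<close>.\<close>
  define u where "u = - poly p' a / poly (Polynomial.pderiv p) a"
  define T where "T g h = poly h a + poly (Polynomial.pderiv g) a * u" for g h
  have Tp: "T p p' = 0" using p'a by (simp add: T_def u_def)
  have Tadd: "T (g + g') (h + h') = T g h + T g' h'" for g h g' h'
    by (simp add: T_def pderiv_add algebra_simps)
  have Tdiff: "T (g - g') (h - h') = T g h - T g' h'" for g h g' h'
    by (simp add: T_def pderiv_diff algebra_simps)
  have Tmult: "T (g * g') (g * h' + g' * h) = poly g a * T g' h' + poly g' a * T g h" for g h g' h'
    by (simp add: T_def pderiv_mult algebra_simps)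
  have zero: "T g h = 0" if "(g, h) \<in> P" "poly g a = 0" for g h
    using that
  proof (induction "Polynomial.degree g" arbitrary: g h rule: less_induct)
    case less
    show ?case
    proof (cases "g = 0")
      case True
      then have "(0, Polynomial.coeff h i) \<in> M" for i using less.prems by (simp add: P_def)
      then have "Polynomial.coeff h i = 0" for i using single M0 by blast
      then have "h = 0" by (simp add: poly_eq_iff)
      then show ?thesis using True by (simp add: T_def)
    next
      case False
      then have deg: "Polynomial.degree p \<le> Polynomial.degree g" using less.prems least by blast
      let ?c = "Polynomial.lead_coeff p" and ?b = "Polynomial.lead_coeff g" and ?k = "Polynomial.degree g - Polynomial.degree p"
      define c' where "c' = Polynomial.coeff p' (Polynomial.degree p)"
      define b' where "b' = Polynomial.coeff h (Polynomial.degree g)"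
      have c': "(?c, c') \<in> M" using p' by (simp add: P_def c'_def)
      have b': "(?b, b') \<in> M" using less.prems by (simp add: P_def b'_def)
      \<comment> \<open>Cross-multiplication by the leading coefficients cancels the leading terms;
        \<open>h1\<close> is the partner of \<open>g1\<close> given by the Leibniz rule in
        \<open>P\<close>.\<close>
      define g1 where "g1 = [:?c:] * g - Polynomial.monom ?b ?k * p"
      define h1 where "h1 = ([:?c:] * h + g * [:c':]) - (Polynomial.monom ?b ?k * p' + p * Polynomial.monom b' ?k)"
      have P1: "(g1, h1) \<in> P" unfolding g1_def h1_def
        by (rule Pdiff[OF Pmult[OF Pconst[OF c'] less.prems(1)] Pmult[OF Pmonom[OF b'] p']])
      have r1: "poly g1 a = 0" using less.prems(2) p by (simp add: g1_def)
      have "Polynomial.degree (Polynomial.monom ?b ?k * p) \<le> Polynomial.degree g"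
        using degree_mult_le[of "Polynomial.monom ?b ?k" p] degree_monom_le[of ?b ?k] deg by linarith
      then have "Polynomial.degree g1 \<le> Polynomial.degree g"
        unfolding g1_def by (intro degree_diff_le) simp_all
      moreover have "Polynomial.coeff g1 (Polynomial.degree g) = 0"
        using deg by (simp add: g1_def coeff_monom_mult)
      ultimately have "g1 = 0 \<or> Polynomial.degree g1 < Polynomial.degree g"
        by (rule eq_zero_or_degree_less)
      \<comment> \<open>This covers \<open>g1 = 0\<close> too: its degree is 0, while
        \<open>g\<close> has at least the positive degree of \<open>p\<close>.\<close>
      then have "Polynomial.degree g1 < Polynomial.degree g"
        using degp deg by auto
      from less.hyps[OF this P1 r1] have "T g1 h1 = 0" .
      \<comment> \<open>All other Leibniz terms contain \<open>poly g a\<close>,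
        \<open>poly p a\<close> or \<open>T p p'\<close>, which vanish.\<close>
      moreover have "T g1 h1 = ?c * T g h"
        unfolding g1_def h1_def Tdiff Tmult using less.prems p Tp by simp
      ultimately show ?thesis using p by simp
    qed
  qed
  \<comment> \<open>Evaluating \<open>g + h \<epsilon>\<close> at \<open>a + u \<epsilon>\<close>
    gives exactly these pairs, so \<open>N\<close> is the ring generated by \<open>M\<close> and
    \<open>(a, u)\<close>.\<close>
  define N where "N = {(poly g a, T g h) | g h. (g, h) \<in> P}"
  have NI: "(poly g a, T g h) \<in> N" if "(g, h) \<in> P" for g h using that by (auto simp: N_def)
  have "M \<subseteq> N"
  proof
    fix z assume "z \<in> M"
    then show "z \<in> N" using NI[OF Pconst, of "fst z" "snd z"] by (simp add: T_def pderiv_pCons)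
  qed
  moreover have "derivation_graph d N"
    unfolding derivation_graph_def
  proof (intro conjI allI impI)
    fix x v w assume "(x, v) \<in> N" "(x, w) \<in> N"
    then obtain g h g' h' where *: "(g, h) \<in> P" "(g', h') \<in> P" "x = poly g a" "x = poly g' a"
      "v = T g h" "w = T g' h'" by (auto simp: N_def)
    from zero[OF Pdiff[OF *(1,2)]] * show "v = w" by (simp add: Tdiff)
  next
    fix c show "(to_ac c, to_ac (d c)) \<in> N" using const \<open>M \<subseteq> N\<close> by blast
  next
    fix x v y w assume "(x, v) \<in> N" "(y, w) \<in> N"
    then obtain g h g' h' where *: "(g, h) \<in> P" "(g', h') \<in> P" "x = poly g a" "y = poly g' a"
      "v = T g h" "w = T g' h'" by (auto simp: N_def)
    show "(x + y, v + w) \<in> N" using NI[OF Padd[OF *(1,2)]] * by (simp add: Tadd)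
    show "(x * y, x * w + y * v) \<in> N" using NI[OF Pmult[OF *(1,2)]] * by (simp add: Tmult)
  qed
  ultimately have "N = M" using max by blast
  \<comment> \<open>The indeterminate itself, whose coefficients have derivative 0, evaluates to
    \<open>(a, u)\<close>.\<close>
  moreover have "([:0, 1:], 0) \<in> P"
    using M0 M1 by (auto simp: P_def coeff_pCons split: nat.split)
  from NI[OF this] have "(a, u) \<in> N" by (simp add: T_def pderiv_pCons)
  ultimately show ?thesis by blast
qed

text \<open>Zorn's lemma for graphs ordered by inclusion: each condition on a graph concerns at most
  two given pairs, and two pairs from the union of a chain lie in a common member. A maximal graph
  is total by \<open>derivation_graph_maximal\<close>.\<close>

lemma derivation_extends_to_alg_closure:
  fixes d :: "'a::field_char_0 \<Rightarrow> 'a"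
  assumes d: "derivation d"
  shows "\<exists>D. derivation D \<and> (\<forall>c. D (to_ac c) = to_ac (d c))"
proof -
  have "derivation_graph d (range (\<lambda>c. (to_ac c, to_ac (d c))))"
    unfolding derivation_graph_def
    by (auto simp: derivation_add[OF d] derivation_mult[OF d] simp flip: to_ac_add to_ac_mult)
  then have ne: "Collect (derivation_graph d) \<noteq> {}" by blast
  have "derivation_graph d (\<Union>\<C>)"
    if ne: "\<C> \<noteq> {}" and chain: "subset.chain (Collect (derivation_graph d)) \<C>" for \<C>
  proof -
    have R: "derivation_graph d R" if "R \<in> \<C>" for R
      using chain that unfolding subset.chain_def by blast
    have two: "\<exists>R\<in>\<C>. z \<in> R \<and> w \<in> R" if "z \<in> \<Union>\<C>" "w \<in> \<Union>\<C>" for z w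
      using chain that unfolding subset_chain_def by blast
    show ?thesis
      unfolding derivation_graph_def
    proof (intro conjI allI impI)
      fix a u v assume "(a, u) \<in> \<Union>\<C>" "(a, v) \<in> \<Union>\<C>"
      then obtain R where "R \<in> \<C>" "(a, u) \<in> R" "(a, v) \<in> R" using two by blast
      then show "u = v" using R unfolding derivation_graph_def by blast
    next
      fix c show "(to_ac c, to_ac (d c)) \<in> \<Union>\<C>"
        using ne R unfolding derivation_graph_def by blast
    next
      fix a u b v assume "(a, u) \<in> \<Union>\<C>" "(b, v) \<in> \<Union>\<C>"
      then obtain S where S: "S \<in> \<C>" "(a, u) \<in> S" "(b, v) \<in> S" using two by blast
      then have "(a + b, u + v) \<in> S" "(a * b, a * v + b * u) \<in> S"
        using R[OF S(1)] unfolding derivation_graph_def by blast+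
      then show "(a + b, u + v) \<in> \<Union>\<C>" "(a * b, a * v + b * u) \<in> \<Union>\<C>" using S(1) by blast+
    qed
  qed
  then have "\<exists>M\<in>Collect (derivation_graph d). \<forall>R\<in>Collect (derivation_graph d). M \<subseteq> R \<longrightarrow> R = M"
    by (intro subset_Zorn_nonempty[OF ne]) simp
  then obtain M where M: "derivation_graph d M"
    and max: "\<And>R. derivation_graph d R \<Longrightarrow> M \<subseteq> R \<Longrightarrow> R = M"
    by blast
  have "\<forall>a. \<exists>u. (a, u) \<in> M"
    using derivation_graph_maximal[OF d M max] by blast
  then obtain D where D: "\<And>a. (a, D a) \<in> M"
    by metis
  have D_eq: "D a = u" if "(a, u) \<in> M" for a u
    using that D[of a] M unfolding derivation_graph_def by blast
  have "D (a + b) = D a + D b" "D (a * b) = a * D b + b * D a" for a b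
    using D[of a] D[of b] M unfolding derivation_graph_def by (blast intro: D_eq)+
  moreover have "D (to_ac c) = to_ac (d c)" for c
    using M unfolding derivation_graph_def by (blast intro: D_eq)
  ultimately show ?thesis unfolding derivation_def by blast
qed

text \<open>Applied to a difference of two extensions, this gives uniqueness. If \<open>p\<close>
  over the base field has least degree among those with root \<open>a\<close>, then
  \<open>0 = D (p(a)) = p'(a) * D a\<close>, and \<open>p'(a)\<close> is nonzero by minimality and
  characteristic zero.\<close>

lemma derivation_alg_closure_eq_0:
  fixes D :: "'a::field_char_0 alg_closure \<Rightarrow> 'a alg_closure"
  assumes D: "derivation D" and 0: "\<And>c. D (to_ac c) = 0"
  shows "D a = 0"
proof -
  let ?root = "\<lambda>p. p \<noteq> 0 \<and> poly (map_poly to_ac p) a = 0"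
  obtain p0 where "?root p0" using alg_closure_algebraic[of a] by metis
  from ex_has_least_nat[of ?root, OF this, of Polynomial.degree]
  obtain p where p: "?root p" and least: "\<And>g. ?root g \<Longrightarrow> Polynomial.degree p \<le> Polynomial.degree g"
    by blast
  have chain: "D (poly (map_poly to_ac g) a) = poly (Polynomial.pderiv (map_poly to_ac g)) a * D a" for g
    by (induction g) (simp_all add: map_poly_pCons pderiv_pCons derivation_0[OF D] derivation_add[OF D]
        derivation_mult[OF D] 0 algebra_simps)
  have pd: "Polynomial.pderiv (map_poly to_ac p) = map_poly to_ac (Polynomial.pderiv p)"
    by (rule poly_eqI) (simp add: coeff_pderiv coeff_map_poly del: of_nat_Suc)
  have "Polynomial.degree p > 0"
  proof (rule ccontr)
    assume "\<not> Polynomial.degree p > 0"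
    then obtain c where "p = [:c:]" using degree_eq_zeroE by blast
    then show False using p by (auto simp: map_poly_pCons)
  qed
  then have "Polynomial.pderiv p \<noteq> 0" "Polynomial.degree (Polynomial.pderiv p) < Polynomial.degree p"
    by (auto simp: pderiv_eq_0_iff degree_pderiv)
  then have "poly (map_poly to_ac (Polynomial.pderiv p)) a \<noteq> 0" using least[of "Polynomial.pderiv p"] by fastforce
  moreover have "D (poly (map_poly to_ac p) a) = 0" using p by (simp add: derivation_0[OF D])
  ultimately show ?thesis using chain[of p] by (simp add: pd)
qed

text \<open>Puts \<open>'n Ky\<close> into the class over which derivations extend to the algebraic
  closure.\<close>

instance fract :: ("{idom, ring_char_0}") field_char_0
proof
  show "inj (of_nat :: nat \<Rightarrow> 'a fract)"
    by (rule injI) (simp add: of_nat_fract eq_fract)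
qed

text \<open>The extension is the quotient rule; the content is its independence of the chosen
  numerator and denominator.\<close>

lemma derivation_extends_to_fract:
  fixes d :: "'a::idom \<Rightarrow> 'a"
  assumes d: "derivation d"
  shows "\<exists>D. derivation D \<and> (\<forall>c. D (Fract c 1) = Fract (d c) 1)"
proof -
  let ?R = "\<lambda>x z. \<exists>p q. q \<noteq> 0 \<and> x = Fract p q \<and> z = Fract (q * d p - p * d q) (q * q)"
  have uniq: "Fract (q * d p - p * d q) (q * q) = Fract (s * d r - r * d s) (s * s)"
    if nz: "q \<noteq> 0" "s \<noteq> 0" and eq: "Fract p q = Fract r s" for p q r s
  proof -
    have e: "p * s = r * q" using nz eq by (simp add: eq_fract)
    then have "d (p * s) = d (r * q)" by simp
    then have e': "p * d s + s * d p = r * d q + q * d r" by (simp add: derivation_mult[OF d])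
    \<comment> \<open>Both summands on the right vanish: \<open>p * s - r * q\<close> by equality of
      the fractions, the other bracket by differentiating that equality.\<close>
    have "(q * d p - p * d q) * (s * s) - (s * d r - r * d s) * (q * q) =
        q * s * (p * d s + s * d p - (r * d q + q * d r)) - (p * s - r * q) * (q * d s + s * d q)"
      by (simp add: algebra_simps)
    then show ?thesis using nz e e' by (simp add: eq_fract)
  qed
  define D where "D x = (THE z. ?R x z)" for x
  have D: "D (Fract p q) = Fract (q * d p - p * d q) (q * q)" if "q \<noteq> 0" for p q
    unfolding D_def
  proof (rule the_equality)
    show "?R (Fract p q) (Fract (q * d p - p * d q) (q * q))" using that by blast
  next
    fix z assume "?R (Fract p q) z"
    then show "z = Fract (q * d p - p * d q) (q * q)" using uniq that by metis
  qed
  have "derivation D"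
    unfolding derivation_def
  proof (intro conjI allI)
    fix a b :: "'a fract"
    obtain p q where a: "a = Fract p q" "q \<noteq> 0" by (cases a)
    obtain r s where b: "b = Fract r s" "s \<noteq> 0" by (cases b)
    show "D (a + b) = D a + D b" "D (a * b) = a * D b + b * D a"
      using a b
      by (simp_all add: D derivation_add[OF d] derivation_mult[OF d] eq_fract algebra_simps)
  qed
  moreover have "D (Fract c 1) = Fract (d c) 1" for c
    by (simp add: D derivation_1[OF d])
  ultimately show ?thesis by blast
qed

text \<open>A polynomial is the sum of its terms, so additive statements reduce to single terms;
  zero counts as a term with coefficient 0.\<close>

lemma mpoly_induct [case_names single add]:
  assumes single: "\<And>t c. P (Poly_Mapping.single t c)"
    and add: "\<And>p q. P p \<Longrightarrow> P q \<Longrightarrow> P (p + q)"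
  shows "P (p :: ('v, 'a::comm_monoid_add) mpoly)"
proof -
  have sum: "p = (\<Sum>t\<in>Poly_Mapping.keys p. Poly_Mapping.single t (Poly_Mapping.lookup p t))"
    by (rule poly_mapping_eqI)
      (simp add: lookup_sum lookup_single when_def in_keys_iff)
  have "P (\<Sum>t\<in>A. Poly_Mapping.single t (Poly_Mapping.lookup p t))" if "finite A" for A
    using that
  proof (induction A rule: finite_induct)
    case empty
    show ?case using single[of 0 0] by simp
  next
    case (insert t A)
    then show ?case by (simp add: add single)
  qed
  then show ?thesis by (subst sum) simp
qed

lemma lookup_map: "f 0 = 0 \<Longrightarrow> Poly_Mapping.lookup (Poly_Mapping.map f p) t = f (Poly_Mapping.lookup p t)"
  by (simp add: Poly_Mapping.map.rep_eq when_def)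

lemma map_add:
  assumes "f 0 = 0" "\<And>a b. f (a + b) = f a + f b"
  shows "Poly_Mapping.map f (p + q) = Poly_Mapping.map f p + Poly_Mapping.map f q"
  by (rule poly_mapping_eqI) (simp add: lookup_map lookup_add assms)

section \<open>Partial derivatives, from polynomials up to the algebraic closure\<close>

lemma mpderiv_single:
  "mpderiv i (Poly_Mapping.single t c) =
     Poly_Mapping.single (t - Poly_Mapping.single i 1) (of_nat (Poly_Mapping.lookup t i) * c)"
  by (simp add: mpderiv_def)

lemma mpderiv_add: "mpderiv i (p + q) = mpderiv i p + mpderiv i q"
  unfolding mpderiv_def
  by (rule setsum_keys_plus_distrib) (simp_all add: algebra_simps single_add)

lemma mpderiv_0: "mpderiv i 0 = 0"
  by (simp add: mpderiv_def)

lemma mpderiv_mult: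
  fixes p q :: "('v, 'a::comm_ring_1) mpoly"
  shows "mpderiv i (p * q) = p * mpderiv i q + q * mpderiv i p"
proof (induction p rule: mpoly_induct)
  case (single s a)
  show ?case
  proof (induction q rule: mpoly_induct)
    case (single t b)
    let ?e = "Poly_Mapping.single i (1::nat)"
    \<comment> \<open>Subtraction of exponents is truncated, so this needs a positive exponent of
      \<open>i\<close> in \<open>t\<close>; otherwise the coefficient \<open>of_nat 0\<close> makes
      both terms zero.\<close>
    have shift: "(s + t) - ?e = s + (t - ?e)" if "Poly_Mapping.lookup t i \<noteq> 0" for s t :: "'v mon"
      using that by (intro poly_mapping_eqI) (auto simp: lookup_add lookup_minus lookup_single when_def)
    have 1: "Poly_Mapping.single (s + (t - ?e)) (a * (of_nat (Poly_Mapping.lookup t i) * b)) =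
        Poly_Mapping.single ((s + t) - ?e) (of_nat (Poly_Mapping.lookup t i) * (a * b))"
      by (cases "Poly_Mapping.lookup t i = 0") (simp_all add: shift mult_ac del: One_nat_def)
    have 2: "Poly_Mapping.single (t + (s - ?e)) (b * (of_nat (Poly_Mapping.lookup s i) * a)) =
        Poly_Mapping.single ((s + t) - ?e) (of_nat (Poly_Mapping.lookup s i) * (a * b))"
      using shift[of s t]
      by (cases "Poly_Mapping.lookup s i = 0") (simp_all add: mult_ac add.commute del: One_nat_def)
    show ?case
      unfolding mult_single mpderiv_single 1 2 by (simp add: lookup_add algebra_simps flip: single_add)
  next
    case (add q q')
    then show ?case by (simp add: mpderiv_add algebra_simps)
  qed
next
  case (add p p')
  then show ?case by (simp add: mpderiv_add algebra_simps)
qed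

lemma derivation_mpderiv: "derivation (mpderiv i :: ('v, 'a::comm_ring_1) mpoly \<Rightarrow> _)"
  by (simp add: derivation_def mpderiv_add mpderiv_mult)

lemma extends_pderiv_derivation: "extends_pderiv j D \<Longrightarrow> derivation D"
  by (auto simp: extends_pderiv_def derivation_def)

text \<open>Justifies the definite description behind \<open>pderiv_bar\<close>. Existence goes
  through the fraction field to its closure; for uniqueness, the difference of two extensions
  vanishes on polynomials, then on fractions, then on the closure.\<close>

lemma extends_pderiv_pderiv_bar: "extends_pderiv j (pderiv_bar j)"
proof -
  obtain d :: "'a Ky \<Rightarrow> 'a Ky" where d: "derivation d" "\<And>c. d (Fract c 1) = Fract (mpderiv j c) 1"
    using derivation_extends_to_fract[OF derivation_mpderiv] by metis
  obtain D :: "'a Kbar \<Rightarrow> 'a Kbar" where D: "derivation D" "\<And>c. D (to_ac c) = to_ac (d c)"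
    using derivation_extends_to_alg_closure[OF d(1)] by metis
  have "extends_pderiv j D"
    using D d(2) by (auto simp: extends_pderiv_def derivation_def Cy_to_Ky_def)
  moreover have "D1 = D2" if D1: "extends_pderiv j D1" and D2: "extends_pderiv j D2"
    for D1 D2 :: "'a Kbar \<Rightarrow> 'a Kbar"
  proof
    fix a
    define E where "E x = D1 x - D2 x" for x
    have E: "derivation E"
      using D1 D2 unfolding derivation_def extends_pderiv_def E_def by (simp add: algebra_simps)
    have E0: "E (to_ac (Fract p 1)) = 0" for p
      using D1 D2 by (simp add: extends_pderiv_def E_def Cy_to_Ky_def)
    have "E (to_ac c) = 0" for c
    proof (cases c)
      case (Fract p q)
      \<comment> \<open>Clearing the denominator and applying \<open>E\<close> leaves
        \<open>q * E c = 0\<close>, since \<open>E\<close> kills \<open>p\<close> and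
        \<open>q\<close>.\<close>
      have "Fract q 1 * Fract p q = Fract p 1" using Fract by (simp add: eq_fract)
      then have "to_ac (Fract q 1) * to_ac c = to_ac (Fract p 1)"
        using Fract by (simp flip: to_ac_mult)
      then have "to_ac (Fract q 1) * E (to_ac c) = 0"
        using derivation_mult[OF E, of "to_ac (Fract q 1)" "to_ac c"] E0 by simp
      moreover have "Fract q 1 \<noteq> 0" using Fract by (simp add: Zero_fract_def eq_fract)
      ultimately show ?thesis by simp
    qed
    then have "E a = 0" by (rule derivation_alg_closure_eq_0[OF E])
    then show "D1 a = D2 a" by (simp add: E_def)
  qed
  ultimately have "\<exists>!D. extends_pderiv j D" by blast
  then show ?thesis unfolding pderiv_bar_def by (rule theI')
qed

section \<open>Evaluation and the chain rule\<close>

definition mon_eval :: "('a::comm_monoid_mult, 'm::finite) vec \<Rightarrow> 'm mon \<Rightarrow> 'a" where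
  "mon_eval \<xi> t = (\<Prod>i\<in>UNIV. (\<xi> $ i) ^ Poly_Mapping.lookup t i)"

lemma mon_eval_0: "mon_eval \<xi> 0 = 1"
  by (simp add: mon_eval_def)

lemma mon_eval_add: "mon_eval \<xi> (s + t) = mon_eval \<xi> s * mon_eval \<xi> t"
  by (simp add: mon_eval_def lookup_add power_add prod.distrib)

lemma mon_eval_single: "mon_eval \<xi> (Poly_Mapping.single i 1) = \<xi> $ i"
proof -
  have "mon_eval \<xi> (Poly_Mapping.single i 1) = (\<Prod>k\<in>UNIV. if k = i then \<xi> $ k else 1)"
    unfolding mon_eval_def by (rule prod.cong) (auto simp: lookup_single when_def)
  then show ?thesis by simp
qed

lemma eval_at_eq: "eval_at p \<xi> = (\<Sum>t\<in>Poly_Mapping.keys p. to_ac (Poly_Mapping.lookup p t) * mon_eval \<xi> t)"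
  by (simp add: eval_at_def mon_eval_def)

lemma eval_at_single: "eval_at (Poly_Mapping.single t c) \<xi> = to_ac c * mon_eval \<xi> t"
  by (simp add: eval_at_eq)

lemma eval_at_add: "eval_at (p + q) \<xi> = eval_at p \<xi> + eval_at q \<xi>"
  unfolding eval_at_eq
  by (rule setsum_keys_plus_distrib) (simp_all add: algebra_simps)

lemma eval_at_0: "eval_at 0 \<xi> = 0"
  by (simp add: eval_at_eq)

lemma eval_at_1: "eval_at 1 \<xi> = 1"
  using eval_at_single[of 0 1 \<xi>] by (simp add: mon_eval_0)

lemma eval_at_diff: "eval_at (p - q) \<xi> = eval_at p \<xi> - eval_at q \<xi>"
  using eval_at_add[of "p - q" q \<xi>] by simp

lemma eval_at_sum: "eval_at (sum f A) \<xi> = (\<Sum>x\<in>A. eval_at (f x) \<xi>)"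
  by (induction A rule: infinite_finite_induct) (auto simp: eval_at_0 eval_at_add)

lemma eval_at_mult: "eval_at (p * q) \<xi> = eval_at p \<xi> * eval_at q \<xi>"
proof (induction p rule: mpoly_induct)
  case (single s a)
  show ?case
  proof (induction q rule: mpoly_induct)
    case (single t b)
    show ?case by (simp add: mult_single eval_at_single mon_eval_add)
  qed (simp add: eval_at_add algebra_simps)
qed (simp add: eval_at_add algebra_simps)

lemma Cy_to_Ky_0: "Cy_to_Ky 0 = 0"
  and Cy_to_Ky_1: "Cy_to_Ky 1 = 1"
  and Cy_to_Ky_add: "Cy_to_Ky (p + q) = Cy_to_Ky p + Cy_to_Ky q"
  and Cy_to_Ky_mult: "Cy_to_Ky (p * q) = Cy_to_Ky p * Cy_to_Ky q"
  and Cy_to_Ky_of_nat: "Cy_to_Ky (of_nat k) = of_nat k"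
  by (simp_all add: Cy_to_Ky_def Zero_fract_def One_fract_def of_nat_fract)

lemma Cyx_to_Kyx_single: "Cyx_to_Kyx (Poly_Mapping.single t c) = Poly_Mapping.single t (Cy_to_Ky c)"
  by (simp add: Cyx_to_Kyx_def Cy_to_Ky_0)

lemma Cyx_to_Kyx_add: "Cyx_to_Kyx (p + q) = Cyx_to_Kyx p + Cyx_to_Kyx q"
  unfolding Cyx_to_Kyx_def by (rule map_add) (simp_all add: Cy_to_Ky_0 Cy_to_Ky_add)

lemma Cyx_to_Kyx_1: "Cyx_to_Kyx 1 = 1"
  using Cyx_to_Kyx_single[of 0 1] by (simp add: Cy_to_Ky_1)

lemma Cyx_to_Kyx_mult: "Cyx_to_Kyx (p * q) = Cyx_to_Kyx p * Cyx_to_Kyx q"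
proof (induction p rule: mpoly_induct)
  case (single s a)
  show ?case
  proof (induction q rule: mpoly_induct)
    case (single t b)
    show ?case by (simp add: mult_single Cyx_to_Kyx_single Cy_to_Ky_mult)
  qed (simp add: Cyx_to_Kyx_add algebra_simps)
qed (simp add: Cyx_to_Kyx_add algebra_simps)

text \<open>The derivative of \<open>f(\<xi>(y), y)\<close> with respect to \<open>y\<^sub>j\<close>.\<close>

lemma chain_rule:
  assumes ext: "extends_pderiv j D"
  shows "D (eval_at (Cyx_to_Kyx f) \<xi>) =
    eval_at (Cyx_to_Kyx (Poly_Mapping.map (mpderiv j) f)) \<xi> +
    (\<Sum>i\<in>UNIV. eval_at (Cyx_to_Kyx (mpderiv i f)) \<xi> * D (\<xi> $ i))"
proof (induction f rule: mpoly_induct)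
  case (single t c)
  have D: "derivation D" by (rule extends_pderiv_derivation[OF ext])
  \<comment> \<open>The exponent of \<open>i\<close> is truncated alike on both sides, so no case
    distinction on whether \<open>i\<close> occurs in \<open>t\<close> arises.\<close>
  have mon: "of_nat (Poly_Mapping.lookup t i) * mon_eval \<xi> (t - Poly_Mapping.single i 1) =
      of_nat (Poly_Mapping.lookup t i) * (\<xi> $ i) ^ (Poly_Mapping.lookup t i - 1) *
      (\<Prod>k\<in>UNIV - {i}. (\<xi> $ k) ^ Poly_Mapping.lookup t k)" for i
  proof -
    have "(\<Prod>k\<in>UNIV - {i}. (\<xi> $ k) ^ Poly_Mapping.lookup (t - Poly_Mapping.single i 1) k) =
        (\<Prod>k\<in>UNIV - {i}. (\<xi> $ k) ^ Poly_Mapping.lookup t k)"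
      by (rule prod.cong) (auto simp: lookup_minus lookup_single when_def)
    then show ?thesis
      by (simp add: mon_eval_def prod.remove[of UNIV i] lookup_minus)
  qed
  have "D (mon_eval \<xi> t) = (\<Sum>i\<in>UNIV. of_nat (Poly_Mapping.lookup t i) *
      mon_eval \<xi> (t - Poly_Mapping.single i 1) * D (\<xi> $ i))"
    unfolding mon_eval_def[of \<xi> t] derivation_prod[OF D finite] mon
    by (rule sum.cong) (simp_all add: derivation_power[OF D] mult_ac)
  moreover have "D (to_ac (Cy_to_Ky c)) = to_ac (Cy_to_Ky (mpderiv j c))"
    using ext by (simp add: extends_pderiv_def)
  ultimately show ?case
    by (simp add: Cyx_to_Kyx_single eval_at_single derivation_mult[OF D] mpderiv_0 mpderiv_single
        Cy_to_Ky_mult Cy_to_Ky_of_nat sum_distrib_left mult_ac)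
next
  case (add f g)
  then show ?case
    by (simp add: Cyx_to_Kyx_add eval_at_add derivation_add[OF extends_pderiv_derivation[OF ext]]
        map_add[where f = "mpderiv j"] mpderiv_0 mpderiv_add algebra_simps sum.distrib)
qed

text \<open>The Leibniz formula expresses a determinant as a polynomial in the entries with
  coefficients 1 and -1, which any ring homomorphism preserves.\<close>

lemma det_ring_hom:
  fixes A :: "(('a::comm_ring_1, 'm::finite) vec, 'm) vec" and \<phi> :: "'a \<Rightarrow> 'b::comm_ring_1"
  assumes add: "\<And>a b. \<phi> (a + b) = \<phi> a + \<phi> b" and mult: "\<And>a b. \<phi> (a * b) = \<phi> a * \<phi> b"
    and one: "\<phi> 1 = 1"
  shows "\<phi> (det A) = det (\<chi> i j. \<phi> (A $ i $ j))"
proof -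
  have 0: "\<phi> 0 = 0" using add[of 0 0] by simp
  have minus: "\<phi> (- a) = - \<phi> a" for a
    using add[of a "- a"] 0 by (simp add: eq_neg_iff_add_eq_0 add.commute)
  have sum: "\<phi> (sum f S) = (\<Sum>x\<in>S. \<phi> (f x))" for f :: "('m \<Rightarrow> 'm) \<Rightarrow> 'a" and S
    by (induction S rule: infinite_finite_induct) (auto simp: 0 add)
  have prod: "\<phi> (prod f S) = (\<Prod>x\<in>S. \<phi> (f x))" for f :: "'m \<Rightarrow> 'a" and S
    by (induction S rule: infinite_finite_induct) (auto simp: one mult)
  have sign: "\<phi> (of_int (sign p)) = of_int (sign p)" for p :: "'m \<Rightarrow> 'm"
    by (simp add: sign_def one minus)
  show ?thesis by (simp add: det_def sum mult prod sign)
qed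

section \<open>Ideals and division\<close>

interpretation ring_module: Modules.module "(*) :: 'a \<Rightarrow> 'a \<Rightarrow> 'a::comm_ring_1"
  by standard (simp_all add: algebra_simps)

lemma ideal_gen_mult: "a \<in> ideal_gen S \<Longrightarrow> r * a \<in> ideal_gen S"
  unfolding ideal_gen_def by (rule ring_module.span_scale)

lemma ideal_gen_diff: "a \<in> ideal_gen S \<Longrightarrow> b \<in> ideal_gen S \<Longrightarrow> a - b \<in> ideal_gen S"
  unfolding ideal_gen_def by (rule ring_module.span_diff)

lemma ideal_gen_sum: "(\<And>x. x \<in> A \<Longrightarrow> f x \<in> ideal_gen S) \<Longrightarrow> sum f A \<in> ideal_gen S"
  unfolding ideal_gen_def by (rule ring_module.span_sum)

lemma ideal_gen_base: "a \<in> S \<Longrightarrow> a \<in> ideal_gen S"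
  unfolding ideal_gen_def by (rule ring_module.span_base)

lemma keys_mult_single:
  fixes p :: "('v, 'a::comm_ring_1) mpoly"
  shows "Poly_Mapping.keys (Poly_Mapping.single u c * p) \<subseteq> (\<lambda>s. u + s) ` Poly_Mapping.keys p"
  using keys_mult[of "Poly_Mapping.single u c" p] by (auto split: if_splits)

section \<open>Monomial orders, the division algorithm and normal forms\<close>

context
  fixes mle :: "'v mon \<Rightarrow> 'v mon \<Rightarrow> bool"
  assumes order: "monomial_order mle"
begin

lemma mle_refl: "mle t t"
  and mle_trans: "mle s t \<Longrightarrow> mle t u \<Longrightarrow> mle s u"
  and mle_antisym: "mle s t \<Longrightarrow> mle t s \<Longrightarrow> s = t"
  and mle_total: "mle s t \<or> mle t s"
  and mle_add: "mle s t \<Longrightarrow> mle (s + u) (t + u)"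
  and wfp_mle: "wfp (\<lambda>s t. mle s t \<and> s \<noteq> t)"
proof -
  interpret linorder mle "\<lambda>s t. mle s t \<and> s \<noteq> t"
    using order unfolding monomial_order_def by blast
  show "mle t t" by (rule order_refl)
  show "mle s t \<Longrightarrow> mle t u \<Longrightarrow> mle s u" by (rule order_trans)
  show "mle s t \<Longrightarrow> mle t s \<Longrightarrow> s = t" by (rule order_antisym)
  show "mle s t \<or> mle t s" by (rule linear)
  show "mle s t \<Longrightarrow> mle (s + u) (t + u)" "wfp (\<lambda>s t. mle s t \<and> s \<noteq> t)"
    using order unfolding monomial_order_def by blast+
qed

text \<open>A finite nonempty set has an \<open>mle\<close>-greatest element, unique by
  antisymmetry, so the description in \<open>lead_mon\<close> denotes.\<close>

lemma lead_mon:
  assumes "p \<noteq> 0"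
  shows lead_mon_in_keys: "lead_mon mle p \<in> Poly_Mapping.keys p"
    and mle_lead_mon: "s \<in> Poly_Mapping.keys p \<Longrightarrow> mle s (lead_mon mle p)"
proof -
  have "\<exists>t\<in>A. \<forall>s\<in>A. mle s t" if "finite A" "A \<noteq> {}" for A
    using that
  proof (induction A rule: finite_ne_induct)
    case (singleton x)
    then show ?case using mle_refl by blast
  next
    case (insert x A)
    then obtain t where t: "t \<in> A" "\<forall>s\<in>A. mle s t" by blast
    show ?case
    proof (cases "mle x t")
      case True
      then show ?thesis using t by blast
    next
      case False
      then have "mle t x" using mle_total by blast
      then have "\<forall>s\<in>insert x A. mle s x" using t mle_trans mle_refl by blast
      then show ?thesis by blast
    qed
  qed
  moreover have "Poly_Mapping.keys p \<noteq> {}" using assms by simp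
  ultimately have "\<exists>t. t \<in> Poly_Mapping.keys p \<and> (\<forall>s\<in>Poly_Mapping.keys p. mle s t)"
    using finite_keys[of p] by blast
  then have "\<exists>!t. t \<in> Poly_Mapping.keys p \<and> (\<forall>s\<in>Poly_Mapping.keys p. mle s t)"
    using mle_antisym by blast
  from theI'[OF this] show "lead_mon mle p \<in> Poly_Mapping.keys p"
    and "s \<in> Poly_Mapping.keys p \<Longrightarrow> mle s (lead_mon mle p)"
    unfolding lead_mon_def by blast+
qed

text \<open>One round of the division algorithm at the bound \<open>t\<close>: if \<open>t\<close>
  is standard, its term moves to the remainder; otherwise a multiple of one element of
  \<open>G\<close> cancels it. What is left lies strictly below \<open>t\<close>.\<close>

lemma division_step:
  fixes g :: "('v, 'a::field) mpoly"
  assumes G: "finite G" "0 \<notin> G" and t: "\<forall>s\<in>Poly_Mapping.keys g. mle s t"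
  shows "\<exists>a r g'. g = (\<Sum>p\<in>G. a p * p) + r + g' \<and>
    (\<forall>p\<in>G. \<forall>s\<in>Poly_Mapping.keys (a p * p). mle s t) \<and>
    Poly_Mapping.keys r \<subseteq> std_monomials mle G \<and>
    (\<forall>s\<in>Poly_Mapping.keys g'. mle s t \<and> s \<noteq> t)"
proof -
  define c where "c = Poly_Mapping.lookup g t"
  show ?thesis
  proof (cases "t \<in> std_monomials mle G")
    case True
    let ?g' = "g - Poly_Mapping.single t c"
    have "\<forall>s\<in>Poly_Mapping.keys ?g'. mle s t \<and> s \<noteq> t"
    proof
      fix s assume "s \<in> Poly_Mapping.keys ?g'"
      then have s: "Poly_Mapping.lookup ?g' s \<noteq> 0" by (simp add: in_keys_iff)
      then have "s \<noteq> t" by (auto simp: lookup_minus c_def)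
      then have "s \<in> Poly_Mapping.keys g" using s by (auto simp: lookup_minus lookup_single in_keys_iff)
      then show "mle s t \<and> s \<noteq> t" using t \<open>s \<noteq> t\<close> by blast
    qed
    moreover have "g = (\<Sum>p\<in>G. 0 * p) + Poly_Mapping.single t c + ?g'" by simp
    moreover have "Poly_Mapping.keys (Poly_Mapping.single t c) \<subseteq> std_monomials mle G"
      using True by simp
    ultimately show ?thesis
      by (intro exI[of _ "\<lambda>_. 0"] exI[of _ "Poly_Mapping.single t c"] exI[of _ ?g']) simp
  next
    case False
    then obtain p where p: "p \<in> G" "lead_term mle p dvd monomial t"
      by (auto simp: std_monomials_def)
    let ?m = "lead_mon mle p"
    let ?l = "Poly_Mapping.lookup p ?m"
    have "p \<noteq> 0" using p G by blast
    then have l: "?l \<noteq> 0" and m: "\<And>s. s \<in> Poly_Mapping.keys p \<Longrightarrow> mle s ?m"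
      using lead_mon by (auto simp: in_keys_iff)
    obtain k where k: "monomial t = lead_term mle p * k" using p(2) by (elim dvdE)
    have "t \<in> Poly_Mapping.keys (lead_term mle p * k)" unfolding k[symmetric] by (simp add: monomial_def)
    then obtain u where u: "t = ?m + u"
      using keys_mult_single[of ?m ?l k] by (auto simp: lead_term_def)
    \<comment> \<open>The multiplier that turns the leading term of \<open>p\<close> into the term
      of \<open>g\<close> at \<open>t\<close>; the rest of \<open>b * p\<close> comes from
      \<open>tail\<close> and stays below \<open>t\<close>.\<close>
    define b where "b = Poly_Mapping.single u (c / ?l)"
    define tail where "tail = p - Poly_Mapping.single ?m ?l"
    have "b * p = b * (Poly_Mapping.single ?m ?l + tail)" by (simp add: tail_def)
    also have "\<dots> = Poly_Mapping.single t c + b * tail"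
      using l by (simp add: b_def distrib_left mult_single u add.commute)
    finally have bp: "b * p = Poly_Mapping.single t c + b * tail" .
    have tail: "s \<in> Poly_Mapping.keys p \<and> s \<noteq> ?m" if "s \<in> Poly_Mapping.keys tail" for s
      using that by (auto simp: tail_def in_keys_iff lookup_minus lookup_single when_def split: if_splits)
    have b_keys: "\<exists>v\<in>Poly_Mapping.keys f. s = v + u" if "s \<in> Poly_Mapping.keys (b * f)" for s f
      using that keys_mult_single[of u "c / ?l" f] by (auto simp: b_def add.commute)
    have btail: "mle s t \<and> s \<noteq> t" if "s \<in> Poly_Mapping.keys (b * tail)" for s
    proof -
      from b_keys[OF that] obtain v where v: "v \<in> Poly_Mapping.keys tail" "s = v + u" by blast
      then have "mle v ?m" "v \<noteq> ?m" using tail m by blast+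
      then show ?thesis using v(2) u mle_add by auto
    qed
    have bpt: "mle s t" if s: "s \<in> Poly_Mapping.keys (b * p)" for s
      using b_keys[OF s] m mle_add u by auto
    let ?g' = "g - b * p"
    have "\<forall>s\<in>Poly_Mapping.keys ?g'. mle s t \<and> s \<noteq> t"
    proof
      fix s assume "s \<in> Poly_Mapping.keys ?g'"
      then have s: "Poly_Mapping.lookup ?g' s \<noteq> 0" by (simp add: in_keys_iff)
      have "Poly_Mapping.lookup (b * tail) t = 0" using btail by (auto simp: in_keys_iff)
      then have "s \<noteq> t" using s by (auto simp: lookup_minus bp lookup_add c_def)
      moreover have "s \<in> Poly_Mapping.keys g \<or> s \<in> Poly_Mapping.keys (b * p)"
        using s by (auto simp: lookup_minus in_keys_iff)
      ultimately show "mle s t \<and> s \<noteq> t" using t bpt by blast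
    qed
    moreover have "g = (\<Sum>q\<in>G. (if q = p then b else 0) * q) + 0 + ?g'"
    proof -
      have "(\<Sum>q\<in>G. (if q = p then b else 0) * q) = (\<Sum>q\<in>G. if q = p then b * p else 0)"
        by (rule sum.cong) auto
      then show ?thesis using G p by simp
    qed
    moreover have "\<forall>q\<in>G. \<forall>s\<in>Poly_Mapping.keys ((if q = p then b else 0) * q). mle s t"
      using bpt by auto
    ultimately show ?thesis
      by (intro exI[of _ "\<lambda>q. if q = p then b else 0"] exI[of _ 0] exI[of _ ?g']) simp
  qed
qed

text \<open>Well-founded induction on the bound: after a step, the leading monomial of the rest
  \<open>g'\<close> is a strictly smaller bound.\<close>

lemma division:
  fixes g :: "('v, 'a::field) mpoly"
  assumes G: "finite G" "0 \<notin> G" and t: "\<forall>s\<in>Poly_Mapping.keys g. mle s t"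
  shows "\<exists>a r. g = (\<Sum>p\<in>G. a p * p) + r \<and>
    (\<forall>p\<in>G. \<forall>s\<in>Poly_Mapping.keys (a p * p). mle s t) \<and>
    Poly_Mapping.keys r \<subseteq> std_monomials mle G"
  using t
proof (induction t arbitrary: g rule: wfp_induct_rule[OF wfp_mle])
  case (1 t)
  from division_step[OF G 1(2)] obtain a r g' where
    step: "g = (\<Sum>p\<in>G. a p * p) + r + g' \<and>
      (\<forall>p\<in>G. \<forall>s\<in>Poly_Mapping.keys (a p * p). mle s t) \<and>
      Poly_Mapping.keys r \<subseteq> std_monomials mle G \<and>
      (\<forall>s\<in>Poly_Mapping.keys g'. mle s t \<and> s \<noteq> t)"
    by (elim exE)
  show ?case
  proof (cases "g' = 0")
    case True
    then show ?thesis using step by (intro exI[of _ a] exI[of _ r]) simp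
  next
    case False
    let ?t' = "lead_mon mle g'"
    have t': "mle ?t' t \<and> ?t' \<noteq> t" using step lead_mon_in_keys[OF False] by blast
    have "\<forall>s\<in>Poly_Mapping.keys g'. mle s ?t'" using mle_lead_mon[OF False] by blast
    from 1(1)[OF t' this] obtain a' r' where
      rest: "g' = (\<Sum>p\<in>G. a' p * p) + r' \<and>
        (\<forall>p\<in>G. \<forall>s\<in>Poly_Mapping.keys (a' p * p). mle s ?t') \<and>
        Poly_Mapping.keys r' \<subseteq> std_monomials mle G"
      by (elim exE)
    have "(\<Sum>p\<in>G. (a p + a' p) * p) = (\<Sum>p\<in>G. a p * p) + (\<Sum>p\<in>G. a' p * p)"
      by (simp only: distrib_right sum.distrib)
    then have "g = (\<Sum>p\<in>G. (a p + a' p) * p) + (r + r')"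
      using step rest by (simp only: add_ac)
    moreover have "mle s t" if "p \<in> G" "s \<in> Poly_Mapping.keys ((a p + a' p) * p)" for p s
    proof -
      have "s \<in> Poly_Mapping.keys (a p * p) \<or> s \<in> Poly_Mapping.keys (a' p * p)"
        using that(2) keys_add[of "a p * p" "a' p * p"] by (auto simp: distrib_right)
      moreover have "mle s t" if "mle s ?t'" using mle_trans that t' by blast
      ultimately show ?thesis using step rest that(1) by fast
    qed
    moreover have "Poly_Mapping.keys (r + r') \<subseteq> std_monomials mle G"
      using keys_add[of r r'] step rest by blast
    ultimately show ?thesis
      by (intro exI[of _ "\<lambda>p. a p + a' p"] exI[of _ "r + r'"]) simp
  qed
qed

lemma remainder_exists:
  fixes g :: "('v, 'a::field) mpoly"
  assumes G: "finite G" "0 \<notin> G"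
  shows "\<exists>r. is_remainder mle G g r"
proof (cases "g = 0")
  \<comment> \<open>The leading monomial of 0 is unspecified, so this case takes all quotients to be
    0, which leaves no bound to check.\<close>
  case True
  then show ?thesis
    unfolding is_remainder_def by (intro exI[of _ 0] conjI exI[of _ "\<lambda>_. 0"]) simp_all
next
  case False
  have "\<forall>s\<in>Poly_Mapping.keys g. mle s (lead_mon mle g)" using mle_lead_mon[OF False] by blast
  from division[OF G this] obtain a r where
    div: "g = (\<Sum>p\<in>G. a p * p) + r \<and>
      (\<forall>p\<in>G. \<forall>s\<in>Poly_Mapping.keys (a p * p). mle s (lead_mon mle g)) \<and>
      Poly_Mapping.keys r \<subseteq> std_monomials mle G"
    by (elim exE)
  have "\<forall>p\<in>G. a p * p \<noteq> 0 \<longrightarrow> mle (lead_mon mle (a p * p)) (lead_mon mle g)"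
    using div lead_mon_in_keys by blast
  then show ?thesis
    unfolding is_remainder_def using div by (intro exI[of _ r] conjI exI[of _ a]) blast+
qed

text \<open>Multiplying a leading term by anything yields only multiples of its monomial, and
  addition creates no new monomials; hence membership in a monomial ideal can be read off each
  monomial separately.\<close>

lemma lead_term_ideal_keys:
  fixes G :: "('v, 'a::field) mpoly set"
  assumes G: "0 \<notin> G" and f: "f \<in> ideal_gen (lead_term mle ` G)"
  shows "\<forall>t\<in>Poly_Mapping.keys f. \<exists>g\<in>G. lead_term mle g dvd monomial t"
  using f unfolding ideal_gen_def
proof (induction f rule: ring_module.span_induct_alt)
  case base
  show ?case by simp
next
  case (step c x y)
  then obtain g where g: "g \<in> G" "x = lead_term mle g" by blast
  let ?m = "lead_mon mle g"
  let ?l = "Poly_Mapping.lookup g ?m"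
  have "g \<noteq> 0" using g(1) G by blast
  then have l: "?l \<noteq> 0" using lead_mon_in_keys by (auto simp: in_keys_iff)
  show ?case
  proof
    fix t assume "t \<in> Poly_Mapping.keys (c * x + y)"
    then consider "t \<in> Poly_Mapping.keys (c * x)" | "t \<in> Poly_Mapping.keys y"
      using keys_add[of "c * x" y] by auto
    then show "\<exists>g\<in>G. lead_term mle g dvd monomial t"
    proof cases
      case 1
      then obtain s where s: "t = ?m + s"
        using keys_mult_single[of ?m ?l c] by (auto simp: g lead_term_def mult.commute)
      \<comment> \<open>Over a field the leading coefficient is inverted, so the term divides the
        monomial with coefficient 1.\<close>
      then have "monomial t = lead_term mle g * Poly_Mapping.single s (inverse ?l)"
        using l by (simp add: monomial_def lead_term_def mult_single)
      then show ?thesis using g(1) by (metis dvdI)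
    next
      case 2
      then show ?thesis using step by blast
    qed
  qed
qed

lemma is_remainder_diff:
  fixes G :: "('v, 'a::field) mpoly set"
  assumes "G \<subseteq> ideal_gen S" "is_remainder mle G g r"
  shows "g - r \<in> ideal_gen S"
proof -
  obtain a where "g = (\<Sum>p\<in>G. a p * p) + r" using assms(2) by (auto simp: is_remainder_def)
  then have "g - r = (\<Sum>p\<in>G. a p * p)" by simp
  then show ?thesis using assms(1) by (auto intro!: ideal_gen_sum ideal_gen_mult)
qed

text \<open>The difference of two remainders lies in the ideal, so by the Groebner property its
  leading monomial is divisible by a leading term of \<open>G\<close>; but only standard monomials
  occur in it.\<close>

lemma remainder_unique:
  fixes G :: "('v, 'a::field) mpoly set"
  assumes groebner: "groebner_basis mle (ideal_gen S) G"
    and r: "is_remainder mle G g r" "is_remainder mle G g r'"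
  shows "r = r'"
proof (rule ccontr)
  assume "r \<noteq> r'"
  then have nz: "r - r' \<noteq> 0" by simp
  have G: "0 \<notin> G" "G \<subseteq> ideal_gen S" using groebner by (auto simp: groebner_basis_def)
  have "(g - r') - (g - r) \<in> ideal_gen S"
    by (rule ideal_gen_diff[OF is_remainder_diff[OF G(2) r(2)] is_remainder_diff[OF G(2) r(1)]])
  then have "r - r' \<in> ideal_gen S - {0}" using nz by simp
  then have "lead_term mle (r - r') \<in> ideal_gen (lead_term mle ` (ideal_gen S - {0}))"
    by (intro ideal_gen_base imageI)
  then have "lead_term mle (r - r') \<in> ideal_gen (lead_term mle ` G)"
    using groebner by (simp add: groebner_basis_def)
  from lead_term_ideal_keys[OF G(1) this]
  have "\<exists>g\<in>G. lead_term mle g dvd monomial (lead_mon mle (r - r'))"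
    using lead_mon_in_keys[OF nz] by (simp add: lead_term_def in_keys_iff)
  moreover have "Poly_Mapping.keys (r - r') \<subseteq> std_monomials mle G"
    using keys_diff[of r r'] r by (auto simp: is_remainder_def)
  ultimately show False
    using lead_mon_in_keys[OF nz] by (auto simp: std_monomials_def)
qed

lemma is_remainder_normal_form:
  fixes G :: "('v, 'a::field) mpoly set"
  assumes groebner: "groebner_basis mle (ideal_gen S) G"
  shows "is_remainder mle G g (normal_form mle G g)"
proof -
  have "finite G" "0 \<notin> G" using groebner by (auto simp: groebner_basis_def)
  then have "\<exists>!r. is_remainder mle G g r"
    using remainder_exists[of G g] remainder_unique[OF groebner] by blast
  then show ?thesis unfolding normal_form_def by (rule theI')
qed

lemma normal_form_cong:
  fixes G :: "('v, 'a::field) mpoly set"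
  assumes groebner: "groebner_basis mle (ideal_gen S) G"
  shows "g - normal_form mle G g \<in> ideal_gen S"
  using is_remainder_diff[OF _ is_remainder_normal_form[OF groebner]] groebner
  by (auto simp: groebner_basis_def)

lemma keys_normal_form:
  fixes G :: "('v, 'a::field) mpoly set"
  assumes groebner: "groebner_basis mle (ideal_gen S) G"
  shows "Poly_Mapping.keys (normal_form mle G g) \<subseteq> std_monomials mle G"
  using is_remainder_normal_form[OF groebner] by (simp add: is_remainder_def)

end

section \<open>Duality and interpolation\<close>

text \<open>Distinct points differ in some coordinate, so a product of factors
  \<open>x_i - \<eta>_i\<close>, one for each other point \<eta>, vanishes at these but not at
  \<xi>. \<open>S\<close> is abstract and closed only under the operations that build this
  product.\<close>

lemma interpolation:
  fixes Z :: "('a::field, 'm::finite) vec set" and S :: "(('a, 'm) vec \<Rightarrow> 'a) set"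
  assumes "finite Z" "\<xi> \<in> Z"
    and one: "(\<lambda>_. 1) \<in> S"
    and add: "\<And>f g. f \<in> S \<Longrightarrow> g \<in> S \<Longrightarrow> (\<lambda>\<eta>. f \<eta> + g \<eta>) \<in> S"
    and scale: "\<And>c f. f \<in> S \<Longrightarrow> (\<lambda>\<eta>. c * f \<eta>) \<in> S"
    and coord: "\<And>i f. f \<in> S \<Longrightarrow> (\<lambda>\<eta>. f \<eta> * \<eta> $ i) \<in> S"
  shows "\<exists>f\<in>S. \<forall>\<eta>\<in>Z. f \<eta> = (if \<eta> = \<xi> then 1 else 0)"
proof -
  have "\<exists>f\<in>S. f \<xi> \<noteq> 0 \<and> (\<forall>\<eta>\<in>A. f \<eta> = 0)" if "finite A" "\<xi> \<notin> A" for A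
    using that
  proof (induction A rule: finite_induct)
    case empty
    show ?case using one by (intro bexI[of _ "\<lambda>_. 1"]) simp_all
  next
    case (insert \<eta> A)
    then obtain f where f: "f \<in> S" "f \<xi> \<noteq> 0" "\<forall>\<eta>\<in>A. f \<eta> = 0" by auto
    obtain i where i: "\<xi> $ i \<noteq> \<eta> $ i" using insert.prems by (auto simp: vec_eq_iff)
    have "(\<lambda>\<zeta>. f \<zeta> * \<zeta> $ i + (- \<eta> $ i) * f \<zeta>) \<in> S"
      by (rule add[OF coord[OF f(1)] scale[OF f(1)]])
    moreover have "f \<xi> * \<xi> $ i + (- \<eta> $ i) * f \<xi> = f \<xi> * (\<xi> $ i - \<eta> $ i)"
      by (simp add: algebra_simps)
    then have "f \<xi> * \<xi> $ i + (- \<eta> $ i) * f \<xi> \<noteq> 0" using f(2) i by simp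
    ultimately show ?case
      using f(3) by (intro bexI[of _ "\<lambda>\<zeta>. f \<zeta> * \<zeta> $ i + (- \<eta> $ i) * f \<zeta>"]) auto
  qed
  from this[of "Z - {\<xi>}"] assms(1) obtain f where
    f: "f \<in> S" "f \<xi> \<noteq> 0" "\<forall>\<eta>\<in>Z - {\<xi>}. f \<eta> = 0" by auto
  have "(\<lambda>\<eta>. inverse (f \<xi>) * f \<eta>) \<in> S" by (rule scale[OF f(1)])
  then show ?thesis
    using f by (intro bexI[of _ "\<lambda>\<eta>. inverse (f \<xi>) * f \<eta>"]) auto
qed

text \<open>Interpolation needs coefficients in the algebraic closure, while division works over
  \<open>'n Ky\<close>. The two meet because only monomials are ever reduced, and closure
  coefficients are attached afterwards. The standard monomials are not yet known to be finite in
  number, so \<open>c\<close> is a finitely supported family.\<close>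

lemma normal_form_interpolation:
  fixes G :: "('m::finite, 'n::{finite,linorder}) Kyx set"
  assumes order: "monomial_order mle" and groebner: "groebner_basis mle (ideal_gen T) G"
    and fin: "finite (zero_set (ideal_gen T))" and \<xi>: "\<xi> \<in> zero_set (ideal_gen T)"
  shows "\<exists>c. Poly_Mapping.keys c \<subseteq> std_monomials mle G \<and>
    (\<forall>\<eta>\<in>zero_set (ideal_gen T).
      (\<Sum>t\<in>Poly_Mapping.keys c. Poly_Mapping.lookup c t * mon_eval \<eta> t) = (if \<eta> = \<xi> then 1 else 0))"
proof -
  let ?B = "std_monomials mle G" and ?Z = "zero_set (ideal_gen T)"
  define ev where "ev c \<eta> = (\<Sum>t\<in>Poly_Mapping.keys c. Poly_Mapping.lookup c t * mon_eval \<eta> t)"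
    for c :: "('m, 'n Kbar) mpoly" and \<eta>
  have ev_add: "ev (c + c') \<eta> = ev c \<eta> + ev c' \<eta>" for c c' \<eta>
    unfolding ev_def by (rule setsum_keys_plus_distrib) (simp_all add: algebra_simps)
  define S where "S = {f. \<exists>c. Poly_Mapping.keys c \<subseteq> ?B \<and> (\<forall>\<eta>\<in>?Z. f \<eta> = ev c \<eta>)}"
  have SI: "f \<in> S" if "Poly_Mapping.keys c \<subseteq> ?B" "\<And>\<eta>. \<eta> \<in> ?Z \<Longrightarrow> f \<eta> = ev c \<eta>" for f c
    using that by (auto simp: S_def)
  have SE: "\<exists>c. Poly_Mapping.keys c \<subseteq> ?B \<and> (\<forall>\<eta>\<in>?Z. f \<eta> = ev c \<eta>)" if "f \<in> S" for f
    using that by (simp add: S_def)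
  have add: "(\<lambda>\<eta>. f \<eta> + g \<eta>) \<in> S" if "f \<in> S" "g \<in> S" for f g
  proof -
    from SE[OF that(1)] obtain c where c: "Poly_Mapping.keys c \<subseteq> ?B" "\<forall>\<eta>\<in>?Z. f \<eta> = ev c \<eta>"
      by blast
    from SE[OF that(2)] obtain c' where c': "Poly_Mapping.keys c' \<subseteq> ?B" "\<forall>\<eta>\<in>?Z. g \<eta> = ev c' \<eta>"
      by blast
    have "Poly_Mapping.keys (c + c') \<subseteq> ?B" using keys_add[of c c'] c c' by blast
    then show ?thesis by (rule SI) (simp add: c c' ev_add)
  qed
  have scale: "(\<lambda>\<eta>. k * f \<eta>) \<in> S" if "f \<in> S" for k f
  proof -
    from SE[OF that] obtain c where c: "Poly_Mapping.keys c \<subseteq> ?B" "\<forall>\<eta>\<in>?Z. f \<eta> = ev c \<eta>"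
      by blast
    let ?c = "Poly_Mapping.map ((*) k) c"
    have keys: "Poly_Mapping.keys ?c \<subseteq> Poly_Mapping.keys c"
      by (auto simp: in_keys_iff lookup_map)
    have "ev ?c \<eta> = k * ev c \<eta>" for \<eta>
    proof -
      have "ev ?c \<eta> = (\<Sum>t\<in>Poly_Mapping.keys c. Poly_Mapping.lookup ?c t * mon_eval \<eta> t)"
        unfolding ev_def
        by (rule sum.mono_neutral_left[OF finite_keys keys])
          (simp add: not_in_keys_iff_lookup_eq_zero)
      also have "\<dots> = k * ev c \<eta>"
        unfolding ev_def sum_distrib_left
        by (rule sum.cong[OF refl]) (simp only: lookup_map mult_zero_right mult.assoc)
      finally show ?thesis .
    qed
    moreover have "Poly_Mapping.keys ?c \<subseteq> ?B" using keys c by blast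
    ultimately show ?thesis using c(2) by (intro SI[of ?c]) simp_all
  qed
  have zero: "(\<lambda>_. 0) \<in> S" by (rule SI[of 0]) (simp_all add: ev_def)
  have sum: "(\<lambda>\<eta>. \<Sum>x\<in>A. f x \<eta>) \<in> S" if "\<And>x. x \<in> A \<Longrightarrow> f x \<in> S"
    for A :: "'m mon set" and f
    using that by (induction A rule: infinite_finite_induct) (simp_all add: zero add)
  have eval: "(\<lambda>\<eta>. eval_at g \<eta>) \<in> S" for g
  proof -
    let ?r = "normal_form mle G g"
    let ?c = "Poly_Mapping.map to_ac ?r"
    have keys: "Poly_Mapping.keys ?c = Poly_Mapping.keys ?r"
      by (auto simp: in_keys_iff lookup_map)
    have "eval_at g \<eta> = ev ?c \<eta>" if "\<eta> \<in> ?Z" for \<eta>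
    proof -
      have "eval_at (g - ?r) \<eta> = 0"
        using that normal_form_cong[OF order groebner] unfolding zero_set_def by blast
      then show ?thesis by (simp add: eval_at_diff ev_def keys eval_at_eq[of ?r] lookup_map)
    qed
    then show ?thesis
      using keys_normal_form[OF order groebner] keys by (intro SI[of ?c]) simp_all
  qed
  have coord: "(\<lambda>\<eta>. f \<eta> * \<eta> $ i) \<in> S" if "f \<in> S" for i f
  proof -
    from SE[OF that] obtain c where c: "Poly_Mapping.keys c \<subseteq> ?B" "\<forall>\<eta>\<in>?Z. f \<eta> = ev c \<eta>"
      by blast
    \<comment> \<open>Multiplication by a coordinate may leave the standard monomials; each shifted
      monomial is a polynomial over \<open>'n Ky\<close>, so \<open>eval\<close> brings it
      back.\<close>
    let ?g = "\<lambda>\<eta>. \<Sum>t\<in>Poly_Mapping.keys c.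
      Poly_Mapping.lookup c t * eval_at (monomial (t + Poly_Mapping.single i 1)) \<eta>"
    have "?g \<in> S" by (rule sum, rule scale, rule eval)
    from SE[OF this] obtain c' where c': "Poly_Mapping.keys c' \<subseteq> ?B" "\<forall>\<eta>\<in>?Z. ?g \<eta> = ev c' \<eta>"
      by blast
    have "f \<eta> * \<eta> $ i = ?g \<eta>" if "\<eta> \<in> ?Z" for \<eta>
    proof -
      have "eval_at (monomial (t + Poly_Mapping.single i 1)) \<eta> = mon_eval \<eta> t * \<eta> $ i" for t
        by (simp only: monomial_def eval_at_single mon_eval_add mon_eval_single to_ac_1 mult_1_left)
      then show ?thesis
        unfolding bspec[OF c(2) that] ev_def sum_distrib_right by (simp only: mult.assoc)
    qed
    then show ?thesis using c' by (intro SI[of c']) simp_all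
  qed
  have one: "(\<lambda>_. 1) \<in> S" using eval[of 1] by (simp add: eval_at_1)
  have "\<exists>f\<in>S. \<forall>\<eta>\<in>?Z. f \<eta> = (if \<eta> = \<xi> then 1 else 0)"
    by (rule interpolation[OF fin \<xi> one add scale coord])
  then obtain f where f: "f \<in> S" "\<forall>\<eta>\<in>?Z. f \<eta> = (if \<eta> = \<xi> then 1 else 0)"
    by (elim bexE)
  from SE[OF f(1)] obtain c where c: "Poly_Mapping.keys c \<subseteq> ?B" "\<forall>\<eta>\<in>?Z. f \<eta> = ev c \<eta>"
    by (elim exE conjE)
  have "ev c \<eta> = (if \<eta> = \<xi> then 1 else 0)" if "\<eta> \<in> ?Z" for \<eta>
    using bspec[OF c(2) that] bspec[OF f(2) that] by simp
  then show ?thesis using c(1) unfolding ev_def by (intro exI[of _ c] conjI ballI)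
qed

text \<open>With \<open>C\<close> the matrix of interpolation coefficients, \<open>A M = 1\<close>
  and \<open>C A = 1\<close> force \<open>M = C\<close>, so \<open>M\<close> is a two-sided
  inverse.\<close>

lemma one_sided_inverse:
  fixes A :: "'b \<Rightarrow> 'z \<Rightarrow> 'k::field_char_0"
  assumes Z: "finite Z"
    and right: "\<And>b b'. b \<in> B \<Longrightarrow> b' \<in> B \<Longrightarrow> (\<Sum>z\<in>Z. A b z * M z b') = (if b = b' then 1 else 0)"
    and left: "\<And>z. z \<in> Z \<Longrightarrow> \<exists>c. Poly_Mapping.keys c \<subseteq> B \<and>
      (\<forall>w\<in>Z. (\<Sum>b\<in>Poly_Mapping.keys c. Poly_Mapping.lookup c b * A b w) = (if w = z then 1 else 0))"
  shows "finite B" "card B = card Z"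
    and "\<And>z w. z \<in> Z \<Longrightarrow> w \<in> Z \<Longrightarrow> (\<Sum>b\<in>B. M z b * A b w) = (if w = z then 1 else 0)"
proof -
  obtain C where C: "\<And>z. z \<in> Z \<Longrightarrow> Poly_Mapping.keys (C z) \<subseteq> B"
    "\<And>z w. z \<in> Z \<Longrightarrow> w \<in> Z \<Longrightarrow>
      (\<Sum>b\<in>Poly_Mapping.keys (C z). Poly_Mapping.lookup (C z) b * A b w) = (if w = z then 1 else 0)"
    using left by metis
  \<comment> \<open>The computation \<open>M = (C A) M = C (A M) = C\<close>; rows of
    \<open>C\<close> have finite support, so the sums can be exchanged.\<close>
  have M: "M z b = Poly_Mapping.lookup (C z) b" if z: "z \<in> Z" and b: "b \<in> B" for z b
  proof -
    have "M z b = (\<Sum>w\<in>Z. (if w = z then 1 else 0) * M w b)"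
      using Z z by (simp add: if_distrib[of "\<lambda>x. x * _"] cong: if_cong)
    also have "\<dots> = (\<Sum>w\<in>Z. (\<Sum>b'\<in>Poly_Mapping.keys (C z). Poly_Mapping.lookup (C z) b' * A b' w) * M w b)"
      using C(2)[OF z] by (intro sum.cong) simp_all
    also have "\<dots> = (\<Sum>b'\<in>Poly_Mapping.keys (C z). Poly_Mapping.lookup (C z) b' * (\<Sum>w\<in>Z. A b' w * M w b))"
      unfolding sum_distrib_right sum_distrib_left mult.assoc by (rule sum.swap)
    also have "\<dots> = (\<Sum>b'\<in>Poly_Mapping.keys (C z). if b' = b then Poly_Mapping.lookup (C z) b else 0)"
      using C(1)[OF z] b by (intro sum.cong) (auto simp: right)
    also have "\<dots> = Poly_Mapping.lookup (C z) b" by (simp add: in_keys_iff)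
    finally show ?thesis .
  qed
  \<comment> \<open>Since \<open>A M = 1\<close>, each \<open>b\<close> has a nonzero entry
    \<open>M z b\<close>, so it lies in one of the finitely many supports.\<close>
  have "B \<subseteq> (\<Union>z\<in>Z. Poly_Mapping.keys (C z))"
  proof
    fix b assume b: "b \<in> B"
    then have "(\<Sum>z\<in>Z. A b z * M z b) \<noteq> 0" by (simp add: right)
    then obtain z where "z \<in> Z" "M z b \<noteq> 0" by (metis (no_types, lifting) mult_zero_right sum.neutral)
    then show "b \<in> (\<Union>z\<in>Z. Poly_Mapping.keys (C z))" using M[OF _ b] by (auto simp: in_keys_iff)
  qed
  then show B: "finite B" by (rule finite_subset) (simp add: Z)
  show inv: "(\<Sum>b\<in>B. M z b * A b w) = (if w = z then 1 else 0)" if z: "z \<in> Z" and w: "w \<in> Z" for z w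
  proof -
    have "(\<Sum>b\<in>B. M z b * A b w) = (\<Sum>b\<in>B. Poly_Mapping.lookup (C z) b * A b w)"
      by (rule sum.cong) (simp_all add: M z)
    also have "\<dots> = (\<Sum>b\<in>Poly_Mapping.keys (C z). Poly_Mapping.lookup (C z) b * A b w)"
      using B C(1)[OF z] by (intro sum.mono_neutral_right) (auto simp: in_keys_iff)
    finally show ?thesis using C(2)[OF z w] by simp
  qed
  \<comment> \<open>The traces of \<open>A M\<close> and \<open>M A\<close> agree; characteristic
    zero turns this into an equality of cardinalities.\<close>
  have "of_nat (card B) = (\<Sum>b\<in>B. \<Sum>z\<in>Z. A b z * M z b)" by (simp add: right)
  also have "\<dots> = (\<Sum>z\<in>Z. \<Sum>b\<in>B. M z b * A b z)" by (subst sum.swap) (simp only: mult.commute)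
  also have "\<dots> = of_nat (card Z)" by (simp add: inv)
  finally show "card B = card Z" by (simp only: of_nat_eq_iff)
qed

section \<open>The pushforward\<close>

lemma det_uminus:
  fixes A :: "(('a::comm_ring_1, 'n::finite) vec, 'n) vec"
  shows "det (- A) = (- 1) ^ CARD('n) * det A"
proof -
  have "- A = (\<chi> i. (- 1) *s A $ i)" by (simp add: vec_eq_iff)
  then show ?thesis using det_rows_mul[of "\<lambda>_. - 1" "\<lambda>i. A $ i"] by simp
qed

lemma eval_at_det:
  fixes A :: "((('m::finite, 'n::{finite,linorder}) Cyx, 'k::finite) vec, 'k) vec"
  shows "eval_at (Cyx_to_Kyx (det A)) \<xi> = det (\<chi> i j. eval_at (Cyx_to_Kyx (A $ i $ j)) \<xi>)"
  by (rule det_ring_hom)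
    (simp_all add: Cyx_to_Kyx_add Cyx_to_Kyx_mult Cyx_to_Kyx_1 eval_at_add eval_at_mult eval_at_1)

text \<open>Implicit differentiation of \<open>F(\<xi>(y), y) = 0\<close>, restricted to the columns
  in \<open>J\<close>, followed by multiplicativity of the determinant; the sign is that of negating
  an m by m matrix. The product form avoids dividing by the Jacobian, which is shown to be nonzero
  only later.\<close>

lemma implicit_jacobian:
  fixes F :: "'m::{finite,linorder} \<Rightarrow> ('m, 'n::{finite,linorder}) Cyx"
  assumes \<xi>: "\<xi> \<in> zero_set (ideal_of F)"
  shows "eval_at (Cyx_to_Kyx (det (jac_x F))) \<xi> * max_minor J (jac_point \<xi>) =
    (- 1) ^ CARD('m) * eval_at (Cyx_to_Kyx (max_minor J (jac_y F))) \<xi>"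
proof -
  let ?X = "\<chi> l i. eval_at (Cyx_to_Kyx (mpderiv i (F l))) \<xi>"
  let ?P = "\<chi> i k. pderiv_bar (nth_col J k) (\<xi> $ i)"
  let ?Y = "\<chi> l k. eval_at (Cyx_to_Kyx (Poly_Mapping.map (mpderiv (nth_col J k)) (F l))) \<xi>"
  have "?X ** ?P = - (?Y :: ((_, 'm) vec, 'm) vec)"
  proof -
    have "(\<Sum>i\<in>UNIV. eval_at (Cyx_to_Kyx (mpderiv i (F l))) \<xi> * pderiv_bar j (\<xi> $ i)) =
        - eval_at (Cyx_to_Kyx (Poly_Mapping.map (mpderiv j) (F l))) \<xi>" for l j
    proof -
      have "Cyx_to_Kyx (F l) \<in> ideal_of F" unfolding ideal_of_def by (rule ideal_gen_base) blast
      then have "eval_at (Cyx_to_Kyx (F l)) \<xi> = 0" using \<xi> by (simp add: zero_set_def)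
      moreover have "pderiv_bar j 0 = 0"
        by (rule derivation_0[OF extends_pderiv_derivation[OF extends_pderiv_pderiv_bar]])
      ultimately show ?thesis
        using chain_rule[OF extends_pderiv_pderiv_bar[of j], of "F l" \<xi>]
        by (simp add: eq_neg_iff_add_eq_0 add.commute)
    qed
    then show ?thesis by (simp add: vec_eq_iff matrix_matrix_mult_def)
  qed
  then have "det ?X * det ?P = (- 1) ^ CARD('m) * det ?Y"
    by (simp only: det_uminus flip: det_mul)
  then show ?thesis
    by (simp add: eval_at_det max_minor_def jac_x_def jac_y_def jac_point_def)
qed

lemma single_sum: "Poly_Mapping.single k (sum f A) = (\<Sum>x\<in>A. Poly_Mapping.single k (f x))"
  by (induction A rule: infinite_finite_induct) (simp_all add: single_add)

theorem mainTheorem7: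
  fixes F :: "'m::{finite,linorder} \<Rightarrow> ('m, 'n::{finite,linorder}) Cyx"
    and I :: "('m, 'n) Kyx set"
    and d :: nat
    and mle :: "'m mon \<Rightarrow> 'm mon \<Rightarrow> bool"
    and G :: "('m, 'n) Kyx set"
    and B :: "'m mon set"
    and \<Delta> :: "'m mon \<Rightarrow> ('m, 'n) Kyx"
    and \<mu> :: "'m mon \<Rightarrow> 'n Ky"
    and h q qinv :: "('m, 'n) Kyx"
  assumes I_def: "I = ideal_of F"
    and zero_dim: "zero_dimensional I"
    and radical: "radical_ideal I"
    and points: "finite (zero_set I)" "card (zero_set I) = d"
    and order: "monomial_order mle"
    and groebner: "groebner_basis mle I G"
    and B_def: "B = std_monomials mle G"
    and dual: "\<And>\<alpha> \<beta>. \<alpha> \<in> B \<Longrightarrow> \<beta> \<in> B \<Longrightarrow>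
      residue_pairing F (monomial \<alpha>) (\<Delta> \<beta>) = (if \<alpha> = \<beta> then 1 else 0)"
    and one: "1 - (\<Sum>\<alpha>\<in>B. mconst (\<mu> \<alpha>) * \<Delta> \<alpha>) \<in> I"
    and no_pole: "zero_set (ideal_sum (ideal_gen {q}) I) = {}"
    and qinv: "q * qinv - 1 \<in> I"
  shows "card B = d \<and>
    pushforward I h q =
      (\<Sum>J | card J = CARD('m).
         Poly_Mapping.single J (to_ac ((-1) ^ CARD('m) *
           (\<Sum>\<alpha>\<in>B. \<mu> \<alpha> * Poly_Mapping.lookup
              (normal_form mle G (Cyx_to_Kyx (max_minor J (jac_y F)) * h * qinv)) \<alpha>))))"
proof -
  define T where "T = range (\<lambda>l. Cyx_to_Kyx (F l))"
  have I: "I = ideal_gen T" by (simp add: I_def ideal_of_def T_def)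
  note gb = groebner[unfolded I]
  let ?Z = "zero_set I"
  let ?n = "\<lambda>g. Poly_Mapping.lookup (normal_form mle G g)"
  define jac where "jac \<xi> = eval_at (Cyx_to_Kyx (det (jac_x F))) \<xi>" for \<xi>
  \<comment> \<open>The inverse Jacobian is absorbed here, so that the residue pairing becomes the
    matrix product in \<open>dual'\<close>.\<close>
  define M where "M \<xi> \<beta> = eval_at (\<Delta> \<beta>) \<xi> * inverse (jac \<xi>)" for \<xi> \<beta>
  have vanish: "eval_at p \<xi> = 0" if "p \<in> I" "\<xi> \<in> ?Z" for p \<xi>
    using that by (simp add: zero_set_def)
  have dual': "(\<Sum>\<xi>\<in>?Z. mon_eval \<xi> \<alpha> * M \<xi> \<beta>) = (if \<alpha> = \<beta> then 1 else 0)"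
    if "\<alpha> \<in> B" "\<beta> \<in> B" for \<alpha> \<beta>
    using dual[OF that]
    unfolding residue_pairing_def residue_def eval_at_mult monomial_def eval_at_single M_def
      jac_def I_def to_ac_1 mult_1_left mult.assoc .
  note interp = normal_form_interpolation[OF order gb, folded I B_def, OF points(1)]
  have finB: "finite B" by (rule one_sided_inverse(1)[OF points(1) dual' interp])
  have cardB: "card B = card ?Z" by (rule one_sided_inverse(2)[OF points(1) dual' interp])
  have left: "(\<Sum>\<beta>\<in>B. M \<xi> \<beta> * mon_eval \<xi> \<beta>) = 1" if "\<xi> \<in> ?Z" for \<xi>
    using one_sided_inverse(3)[OF points(1) dual' interp, of \<xi> \<xi>] that by simp
  \<comment> \<open>As \<open>inverse 0 = 0\<close>, a vanishing Jacobian would make the whole row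
    of \<open>M\<close> zero, contradicting \<open>left\<close>.\<close>
  have jac_nz: "jac \<xi> \<noteq> 0" if "\<xi> \<in> ?Z" for \<xi>
    using left[OF that] by (auto simp: M_def)
  \<comment> \<open>The residue of \<open>g\<close> is its pairing with 1: expand \<open>g\<close>
    in standard monomials and 1 in the dual basis, and \<open>dual'\<close> leaves the diagonal
    terms.\<close>
  have res: "(\<Sum>\<xi>\<in>?Z. eval_at g \<xi> * inverse (jac \<xi>)) = to_ac (\<Sum>\<alpha>\<in>B. \<mu> \<alpha> * ?n g \<alpha>)" for g
  proof -
    have "eval_at g \<xi> * inverse (jac \<xi>) =
        (\<Sum>\<alpha>\<in>B. \<Sum>\<beta>\<in>B. to_ac (?n g \<alpha> * \<mu> \<beta>) * (mon_eval \<xi> \<alpha> * M \<xi> \<beta>))"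
      if \<xi>: "\<xi> \<in> ?Z" for \<xi>
    proof -
      have "eval_at g \<xi> = eval_at (normal_form mle G g) \<xi>"
        using vanish[OF normal_form_cong[OF order gb, folded I] \<xi>] by (simp add: eval_at_diff)
      also have "\<dots> = (\<Sum>\<alpha>\<in>B. to_ac (?n g \<alpha>) * mon_eval \<xi> \<alpha>)"
        unfolding eval_at_eq
        using finB keys_normal_form[OF order gb] B_def
        by (intro sum.mono_neutral_left) (auto simp: in_keys_iff)
      finally have g: "eval_at g \<xi> = (\<Sum>\<alpha>\<in>B. to_ac (?n g \<alpha>) * mon_eval \<xi> \<alpha>)" .
      have "(\<Sum>\<beta>\<in>B. to_ac (\<mu> \<beta>) * eval_at (\<Delta> \<beta>) \<xi>) = 1"
        using vanish[OF one \<xi>]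
        unfolding eval_at_diff eval_at_1 eval_at_sum eval_at_mult mconst_def eval_at_single mon_eval_0
        by simp
      \<comment> \<open>The expansion of 1 enters as a factor 1, which writes the inverse Jacobian
        as a combination of entries of \<open>M\<close>.\<close>
      then have "inverse (jac \<xi>) = (\<Sum>\<beta>\<in>B. to_ac (\<mu> \<beta>) * eval_at (\<Delta> \<beta>) \<xi>) * inverse (jac \<xi>)"
        by simp
      also have "\<dots> = (\<Sum>\<beta>\<in>B. to_ac (\<mu> \<beta>) * M \<xi> \<beta>)"
        unfolding sum_distrib_right M_def by (simp only: mult.assoc)
      finally have j: "inverse (jac \<xi>) = (\<Sum>\<beta>\<in>B. to_ac (\<mu> \<beta>) * M \<xi> \<beta>)" .
      show ?thesis
        unfolding g unfolding j sum_product to_ac_mult by (simp only: mult_ac)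
    qed
    then have "(\<Sum>\<xi>\<in>?Z. eval_at g \<xi> * inverse (jac \<xi>)) =
        (\<Sum>\<xi>\<in>?Z. \<Sum>\<alpha>\<in>B. \<Sum>\<beta>\<in>B. to_ac (?n g \<alpha> * \<mu> \<beta>) * (mon_eval \<xi> \<alpha> * M \<xi> \<beta>))"
      by (rule sum.cong[OF refl])
    also have "\<dots> = (\<Sum>\<alpha>\<in>B. \<Sum>\<xi>\<in>?Z. \<Sum>\<beta>\<in>B. to_ac (?n g \<alpha> * \<mu> \<beta>) * (mon_eval \<xi> \<alpha> * M \<xi> \<beta>))"
      by (rule sum.swap)
    also have "\<dots> = (\<Sum>\<alpha>\<in>B. \<Sum>\<beta>\<in>B. to_ac (?n g \<alpha> * \<mu> \<beta>) * (\<Sum>\<xi>\<in>?Z. mon_eval \<xi> \<alpha> * M \<xi> \<beta>))"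
      unfolding sum_distrib_left by (intro sum.cong refl sum.swap)
    also have "\<dots> = (\<Sum>\<alpha>\<in>B. \<Sum>\<beta>\<in>B. if \<beta> = \<alpha> then to_ac (?n g \<alpha> * \<mu> \<alpha>) else 0)"
      by (intro sum.cong refl) (auto simp: dual')
    also have "\<dots> = to_ac (\<Sum>\<alpha>\<in>B. \<mu> \<alpha> * ?n g \<alpha>)"
      using finB by (simp add: to_ac_sum mult.commute)
    finally show ?thesis .
  qed
  have coeff: "(\<Sum>\<xi>\<in>?Z. eval_at h \<xi> / eval_at q \<xi> * max_minor J (jac_point \<xi>)) =
      to_ac ((-1) ^ CARD('m) *
        (\<Sum>\<alpha>\<in>B. \<mu> \<alpha> * ?n (Cyx_to_Kyx (max_minor J (jac_y F)) * h * qinv) \<alpha>))" for J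
  proof -
    let ?g = "Cyx_to_Kyx (max_minor J (jac_y F)) * h * qinv"
    have "eval_at h \<xi> / eval_at q \<xi> * max_minor J (jac_point \<xi>) =
        (-1) ^ CARD('m) * (eval_at ?g \<xi> * inverse (jac \<xi>))" if \<xi>: "\<xi> \<in> ?Z" for \<xi>
    proof -
      have "eval_at q \<xi> * eval_at qinv \<xi> = 1"
        using vanish[OF qinv \<xi>] unfolding eval_at_diff eval_at_mult eval_at_1 by simp
      then have hq: "eval_at h \<xi> / eval_at q \<xi> = eval_at h \<xi> * eval_at qinv \<xi>"
        by (simp only: divide_inverse inverse_unique)
      \<comment> \<open>Inserting the Jacobian and its inverse lets \<open>implicit_jacobian\<close>
        trade the minor of derivatives of \<xi> for a minor of \<open>jac_y F\<close>, making the
        summand that of a residue.\<close>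
      have "max_minor J (jac_point \<xi>) = inverse (jac \<xi>) * (jac \<xi> * max_minor J (jac_point \<xi>))"
        using jac_nz[OF \<xi>] by simp
      also have "jac \<xi> * max_minor J (jac_point \<xi>) =
          (- 1) ^ CARD('m) * eval_at (Cyx_to_Kyx (max_minor J (jac_y F))) \<xi>"
        unfolding jac_def by (rule implicit_jacobian[OF \<xi>[unfolded I_def]])
      finally have m: "max_minor J (jac_point \<xi>) =
          inverse (jac \<xi>) * ((- 1) ^ CARD('m) * eval_at (Cyx_to_Kyx (max_minor J (jac_y F))) \<xi>)" .
      show ?thesis unfolding hq m eval_at_mult by (simp only: mult_ac)
    qed
    then have "(\<Sum>\<xi>\<in>?Z. eval_at h \<xi> / eval_at q \<xi> * max_minor J (jac_point \<xi>)) =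
        (-1) ^ CARD('m) * (\<Sum>\<xi>\<in>?Z. eval_at ?g \<xi> * inverse (jac \<xi>))"
      unfolding sum_distrib_left by (rule sum.cong[OF refl])
    then show ?thesis
      unfolding res to_ac_mult to_ac_power to_ac_minus to_ac_1 .
  qed
  have "pushforward I h q = (\<Sum>J | card J = CARD('m). Poly_Mapping.single J
      (\<Sum>\<xi>\<in>?Z. eval_at h \<xi> / eval_at q \<xi> * max_minor J (jac_point \<xi>)))"
    unfolding pushforward_def pullback_def single_sum by (rule sum.swap)
  then show ?thesis using cardB points(2) by (simp only: coeff)
qed

end
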